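(* Let $\mathcal{R}$ be a fusion ring with basis $\{x_1=1,\ldots,x_m\}$, fusion matrices $M_j$ and $d_j=\|M_j\|$, and let $\mathcal{B}=\mathcal{R}\otimes_{\mathbb{Z}}\mathbb{C}$ with its $C^*$-algebra structure. Let $\Delta:\mathcal{B}\to\mathcal{B}\otimes\mathcal{B}$ be the linear map with $\Delta(x_j)=\frac{1}{d_j}x_j\otimes x_j$, and for $n\ge1$ let $T_n=\sum_{i=1}^m\|M_i\|^2\big(M_i/\|M_i\|\big)^{\otimes n}$ be the primary $n$-matrix. The following are equivalent: (1) $\Delta$ is completely positive; (2) $T_3\geq0$; (3) $T_n\geq0$ for some $n\geq 3$; (4) $T_n\geq 0$ for every $n\in\mathbb{N}$, $n\ge1$.
   Context: A fusion ring is a ring $\mathcal{R}$ which is a free $\mathbb{Z}$-module with a finite basis $\{x_1=1,\ldots,x_m\}$ such that $x_ix_j=\sum_k N_{ij}^k x_k$ with $N_{ij}^k\in\mathbb{N}$; there is an involution $i\mapsto i^*$ whose $\mathbb{Z}$-linear extension is an anti-involution of $\mathcal{R}$; and the coefficient of $x_1$ in $x_ix_j$ equals $\delta_{i,j^*}$. $\mathcal{B}=\mathcal{R}\otimes_\mathbb{Z}\mathbb{C}$ is the complex algebra with involution $(\sum c_jx_j)^*=\sum\overline{c_j}x_{j^*}$ and faithful trace $\tau(x_j)=\delta_{j,1}$; it is a finite-dimensional $C^*$-algebra (acting on $L^2(\mathcal{B},\tau)$, in which $\{x_j\}$ is orthonormal). The fusion matrix $M_j$ is the matrix of left multiplication by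 $x_j$, $(M_j)_{k,i}=N_{ji}^k$, and $\|M_j\|$ its operator norm on $\mathbb{C}^m$. $A\geq0$ means positive semidefinite. *)

theory Defs
  imports Complex_Main
begin

text \<open>A fusion ring of rank m: basis x_0 = 1, x_1, ..., x_(m-1) (indices 0..<m; the paper's x_1 is
  our index 0), structure constants N i j k = N_{ij}^k (coefficient of x_k in x_i x_j),
  involution i -> dual i.\<close>
definition fusion_ring :: "nat \<Rightarrow> (nat \<Rightarrow> nat \<Rightarrow> nat \<Rightarrow> nat) \<Rightarrow> (nat \<Rightarrow> nat) \<Rightarrow> bool" where
  "fusion_ring m N dual \<longleftrightarrow>
     0 < m \<and>
     (\<forall>i<m. dual i < m \<and> dual (dual i) = i) \<and>
     (\<forall>i<m. \<forall>k<m. N 0 i k = (if i = k then 1 else 0) \<and> N i 0 k = (if i = k then 1 else 0)) \<and>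
     (\<forall>i<m. \<forall>j<m. \<forall>k<m. \<forall>p<m.
        (\<Sum>l<m. N i j l * N l k p) = (\<Sum>l<m. N j k l * N i l p)) \<and>
     (\<forall>i<m. \<forall>j<m. \<forall>k<m. N (dual j) (dual i) (dual k) = N i j k) \<and>
     (\<forall>i<m. \<forall>j<m. N i j 0 = (if i = dual j then 1 else 0))"

definition fmat :: "(nat \<Rightarrow> nat \<Rightarrow> nat \<Rightarrow> nat) \<Rightarrow> nat \<Rightarrow> nat \<Rightarrow> nat \<Rightarrow> complex" where
  "fmat N j k i = of_nat (N j i k)"

definition opnorm :: "nat \<Rightarrow> (nat \<Rightarrow> nat \<Rightarrow> complex) \<Rightarrow> real" where
  "opnorm m A = Sup {sqrt (\<Sum>a<m. (cmod (\<Sum>b<m. A a b * v b))\<^sup>2) | v.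
                      (\<Sum>b<m. (cmod (v b))\<^sup>2) \<le> 1}"

definition dnorm :: "nat \<Rightarrow> (nat \<Rightarrow> nat \<Rightarrow> nat \<Rightarrow> nat) \<Rightarrow> nat \<Rightarrow> real" where
  "dnorm m N j = opnorm m (fmat N j)"

definition psd :: "'i set \<Rightarrow> ('i \<Rightarrow> 'i \<Rightarrow> complex) \<Rightarrow> bool" where
  "psd I A \<longleftrightarrow> (\<forall>v. let q = (\<Sum>a\<in>I. \<Sum>b\<in>I. cnj (v a) * A a b * v b) in Im q = 0 \<and> Re q \<ge> 0)"

text \<open>Left regular representation of b = sum_j c_j x_j on L^2(B,tau) = C^m: sum_j c_j M_j.\<close>
definition Bmat :: "nat \<Rightarrow> (nat \<Rightarrow> nat \<Rightarrow> nat \<Rightarrow> nat) \<Rightarrow> (nat \<Rightarrow> complex) \<Rightarrow> nat \<Rightarrow> nat \<Rightarrow> complex" where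
  "Bmat m N c a b = (\<Sum>j<m. c j * fmat N j a b)"

text \<open>Representation on L^2(B) (x) L^2(B) of Delta(b) = sum_j (c_j/d_j) x_j (x) x_j.\<close>
definition Delta_mat :: "nat \<Rightarrow> (nat \<Rightarrow> nat \<Rightarrow> nat \<Rightarrow> nat) \<Rightarrow> (nat \<Rightarrow> complex)
     \<Rightarrow> nat \<times> nat \<Rightarrow> nat \<times> nat \<Rightarrow> complex" where
  "Delta_mat m N c = (\<lambda>(a, a') (b, b').
      (\<Sum>j<m. c j / complex_of_real (dnorm m N j) * fmat N j a b * fmat N j a' b'))"

definition Mk_pos :: "nat \<Rightarrow> 'i set \<Rightarrow> (nat \<Rightarrow> nat \<Rightarrow> 'i \<Rightarrow> 'i \<Rightarrow> complex) \<Rightarrow> bool" where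
  "Mk_pos k I A = psd ({0..<k} \<times> I) (\<lambda>(p, x) (q, y). A p q x y)"

text \<open>Delta is completely positive: for every k, Delta applied entrywise maps positive elements
  of M_k(B) to positive elements of M_k(B (x) B). An element of M_k(B) is given by
  coefficients C p q j (entry (p,q) is sum_j C p q j x_j).\<close>
definition Delta_cp :: "nat \<Rightarrow> (nat \<Rightarrow> nat \<Rightarrow> nat \<Rightarrow> nat) \<Rightarrow> bool" where
  "Delta_cp m N \<longleftrightarrow> (\<forall>k C. Mk_pos k {0..<m} (\<lambda>p q. Bmat m N (C p q)) \<longrightarrow>
        Mk_pos k ({0..<m} \<times> {0..<m}) (\<lambda>p q. Delta_mat m N (C p q)))"

definition tuples :: "nat \<Rightarrow> nat \<Rightarrow> nat list set" where
  "tuples m n = {xs. length xs = n \<and> set xs \<subseteq> {0..<m}}"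

definition primary_mat :: "nat \<Rightarrow> (nat \<Rightarrow> nat \<Rightarrow> nat \<Rightarrow> nat) \<Rightarrow> nat \<Rightarrow> nat list \<Rightarrow> nat list \<Rightarrow> complex" where
  "primary_mat m N n xs ys = (\<Sum>i<m. complex_of_real ((dnorm m N i)\<^sup>2) *
      (\<Prod>t<n. fmat N i (xs ! t) (ys ! t) / complex_of_real (dnorm m N i)))"

definition primary_psd :: "nat \<Rightarrow> (nat \<Rightarrow> nat \<Rightarrow> nat \<Rightarrow> nat) \<Rightarrow> nat \<Rightarrow> bool" where
  "primary_psd m N n = psd (tuples m n) (primary_mat m N n)"

end

theory Submission
  imports Defs "HOL-Analysis.Function_Topology" "HOL-Analysis.Topology_Euclidean_Space" "HOL-Analysis.Convex"
begin

text \<open>Let \<open>T'\<close> be \<open>T\<^sub>3\<close> with \<open>M\<^sub>j\<close> in the first factor replaced by the right multiplication by \<open>x\<^bsub>j*\<^esub>\<close>; the two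
  are unitarily equivalent through the involution of the basis. If \<open>X = \<Sum>\<^sub>j X\<^sub>j \<otimes> x\<^sub>j\<close> is a positive element of
  \<open>M\<^sub>k(\<B>)\<close>, then \<open>X \<otimes> 1\<close> and \<open>1 \<otimes> T'\<close> commute, because left and right multiplications do, so their product
  is positive if \<open>T\<^sub>3 \<ge> 0\<close>. Since \<open>\<tau>(x\<^sub>i x\<^bsub>j*\<^esub>) = \<delta>\<^sub>i\<^sub>j\<close>, compressing that product to the vector \<open>x\<^sub>1\<close> of the shared
  factor \<open>L\<^sup>2(\<B>)\<close> yields \<open>\<Delta>(X)\<close>, and \<open>\<Delta>\<close> is completely positive.

  Conversely \<open>\<Delta>\<close> sends \<open>x\<^sub>j / d\<^sub>j\<close> to its tensor square, so applying it to one tensor factor turns \<open>T\<^sub>n\<close> into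
  \<open>T\<^bsub>n+1\<^esub>\<close>, and \<open>T\<^sub>1\<close> has the entries \<open>d\<^sub>k d\<^sub>i\<close> and so is positive. Finally \<open>(d\<^sub>j)\<close> is an eigenvector of \<open>M\<^sub>i\<close> with
  eigenvalue \<open>d\<^sub>i\<close>; pairing one tensor factor with it turns \<open>T\<^bsub>n+1\<^esub>\<close> into a positive multiple of \<open>T\<^sub>n\<close>.\<close>

section \<open>Positive semidefinite kernels on a finite set\<close>

definition kapp :: "'i set \<Rightarrow> ('i \<Rightarrow> 'i \<Rightarrow> complex) \<Rightarrow> ('i \<Rightarrow> complex) \<Rightarrow> 'i \<Rightarrow> complex" where
  "kapp I A v a = (\<Sum>b\<in>I. A a b * v b)"

definition kinner :: "'i set \<Rightarrow> ('i \<Rightarrow> complex) \<Rightarrow> ('i \<Rightarrow> complex) \<Rightarrow> complex" where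
  "kinner I v w = (\<Sum>a\<in>I. cnj (v a) * w a)"

definition kmult :: "'i set \<Rightarrow> ('i \<Rightarrow> 'i \<Rightarrow> complex) \<Rightarrow> ('i \<Rightarrow> 'i \<Rightarrow> complex) \<Rightarrow> 'i \<Rightarrow> 'i \<Rightarrow> complex" where
  "kmult I A B a c = (\<Sum>b\<in>I. A a b * B b c)"

definition hermitian_on :: "'i set \<Rightarrow> ('i \<Rightarrow> 'i \<Rightarrow> complex) \<Rightarrow> bool" where
  "hermitian_on I A \<longleftrightarrow> (\<forall>a\<in>I. \<forall>b\<in>I. A a b = cnj (A b a))"

section \<open>Sesquilinear algebra of kernels\<close>

lemma quadratic_form_eq:
  "(\<Sum>a\<in>I. \<Sum>b\<in>I. cnj (v a) * A a b * v b) = kinner I v (kapp I A v)"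
  by (simp add: kinner_def kapp_def sum_distrib_left mult.assoc)

lemma psd_iff:
  "psd I A \<longleftrightarrow> (\<forall>v. Im (kinner I v (kapp I A v)) = 0 \<and> 0 \<le> Re (kinner I v (kapp I A v)))"
  by (simp add: psd_def Let_def quadratic_form_eq)

lemma psd_cong:
  assumes "\<And>a b. a \<in> I \<Longrightarrow> b \<in> I \<Longrightarrow> A a b = B a b"
  shows "psd I A \<longleftrightarrow> psd I B"
  unfolding psd_def Let_def using assms by simp

text \<open>Tensor products are indexed below by lists and by nested pairs in several bracketings;
  positivity has to move between these index sets.\<close>

lemma psd_reindex:
  assumes f: "bij_betw f I J" and A: "\<And>a b. a \<in> I \<Longrightarrow> b \<in> I \<Longrightarrow> A a b = B (f a) (f b)"
  shows "psd I A \<longleftrightarrow> psd J B"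
proof -
  define qI where "qI = (\<lambda>v. \<Sum>a\<in>I. \<Sum>b\<in>I. cnj (v a) * A a b * v b)"
  define qJ where "qJ = (\<lambda>v. \<Sum>a\<in>J. \<Sum>b\<in>J. cnj (v a) * B a b * v b)"
  have *: "qJ v = qI (\<lambda>i. v (f i))" for v
    unfolding qI_def qJ_def by (simp add: sum.reindex_bij_betw[OF f, symmetric] A cong: sum.cong)
  have **: "qI v = qJ (\<lambda>j. v (the_inv_into I f j))" for v
    unfolding * using f unfolding qI_def
    by (intro sum.cong refl) (simp_all add: bij_betw_def the_inv_into_f_f)
  have "psd I A \<longleftrightarrow> (\<forall>v. Im (qI v) = 0 \<and> 0 \<le> Re (qI v))"
    by (simp add: psd_def qI_def)
  also have "\<dots> \<longleftrightarrow> (\<forall>v. Im (qJ v) = 0 \<and> 0 \<le> Re (qJ v))"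
    by (metis * **)
  also have "\<dots> \<longleftrightarrow> psd J B"
    by (simp add: psd_def qJ_def)
  finally show ?thesis .
qed

lemma kinner_self: "kinner I v v = of_real (\<Sum>a\<in>I. (cmod (v a))\<^sup>2)"
  by (simp add: kinner_def complex_norm_square mult.commute del: of_real_power)

lemma kinner_self_eq_0:
  assumes "finite I" "kinner I v v = 0" "a \<in> I"
  shows "v a = 0"
proof -
  have "(\<Sum>a\<in>I. (cmod (v a))\<^sup>2) = 0"
    using assms(2) unfolding kinner_self of_real_eq_0_iff .
  thus ?thesis using assms by (simp add: sum_nonneg_eq_0_iff)
qed

lemma kinner_cnj: "cnj (kinner I v w) = kinner I w v"
  by (simp add: kinner_def mult.commute)

lemma kinner_cong:
  "(\<And>a. a \<in> I \<Longrightarrow> v a = v' a) \<Longrightarrow> (\<And>a. a \<in> I \<Longrightarrow> w a = w' a) \<Longrightarrow> kinner I v w = kinner I v' w'"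
  by (simp add: kinner_def)

lemma kinner_scale_right: "kinner I v (\<lambda>a. c * w a) = c * kinner I v w"
  by (simp add: kinner_def sum_distrib_left mult.left_commute)

lemma kinner_scale_left: "kinner I (\<lambda>a. c * v a) w = cnj c * kinner I v w"
  by (simp add: kinner_def sum_distrib_left mult.assoc)

lemma kinner_diff_right: "kinner I v (\<lambda>a. w a - z a) = kinner I v w - kinner I v z"
  by (simp add: kinner_def algebra_simps sum_subtractf)

lemma kinner_diff_left: "kinner I (\<lambda>a. v a - z a) w = kinner I v w - kinner I z w"
  by (simp add: kinner_def algebra_simps sum_subtractf)

lemma kapp_diff: "kapp I A (\<lambda>a. v a - z a) = (\<lambda>a. kapp I A v a - kapp I A z a)"
  by (simp add: kapp_def algebra_simps sum_subtractf fun_eq_iff)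

lemma kapp_scale: "kapp I A (\<lambda>a. c * v a) = (\<lambda>a. c * kapp I A v a)"
  by (simp add: kapp_def sum_distrib_left mult.left_commute fun_eq_iff)

lemma kapp_kmult: "kapp I (kmult I A B) v = kapp I A (kapp I B v)"
  unfolding kapp_def kmult_def sum_distrib_left sum_distrib_right fun_eq_iff
  by (subst sum.swap) (simp add: mult.assoc)

lemma kapp_cong:
  "(\<And>b. b \<in> I \<Longrightarrow> v b = w b) \<Longrightarrow> kapp I A v = kapp I A w"
  by (simp add: kapp_def fun_eq_iff)

section \<open>Hermitian and positive kernels: null vectors, least eigenvalues, commuting
  products\<close>

lemma hermitian_adjoint:
  assumes "hermitian_on I A"
  shows "kinner I v (kapp I A w) = kinner I (kapp I A v) w"
proof -
  have "kinner I (kapp I A v) w = (\<Sum>a\<in>I. \<Sum>b\<in>I. cnj (A a b) * cnj (v b) * w a)"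
    by (simp add: kinner_def kapp_def sum_distrib_right)
  also have "\<dots> = (\<Sum>b\<in>I. \<Sum>a\<in>I. cnj (A a b) * cnj (v b) * w a)"
    by (rule sum.swap)
  also have "\<dots> = (\<Sum>b\<in>I. \<Sum>a\<in>I. cnj (v b) * (A b a * w a))"
  proof (intro sum.cong refl)
    fix a b assume "a \<in> I" "b \<in> I"
    hence "A b a = cnj (A a b)"
      using assms unfolding hermitian_on_def by blast
    thus "cnj (A a b) * cnj (v b) * w a = cnj (v b) * (A b a * w a)" by simp
  qed
  finally show ?thesis by (simp add: kinner_def kapp_def sum_distrib_left)
qed

text \<open>Polarization: the form is real at e_a - e_b and at e_a - i e_b, which compares the
  imaginary and the real parts of the two entries.\<close>

lemma psd_hermitian:
  assumes fin: "finite I" and A: "psd I A"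
  shows "hermitian_on I A"
  unfolding hermitian_on_def
proof (intro ballI)
  fix a b assume ab: "a \<in> I" "b \<in> I"
  define e where "e = (\<lambda>(a::'a) i. if i = a then 1 else (0::complex))"
  have k: "kapp I A (e b) = (\<lambda>a. A a b)" if "b \<in> I" for b
    using that fin by (simp add: kapp_def e_def fun_eq_iff if_distrib cong: if_cong)
  have i: "kinner I (e a) w = w a" if "a \<in> I" for a w
    using that fin by (simp add: kinner_def e_def fun_eq_iff if_distrib[of cnj] if_distrib[of "\<lambda>x. x * _"] cong: if_cong)
  have q: "kinner I (\<lambda>i. e a i - c * e b i) (kapp I A (\<lambda>i. e a i - c * e b i))
     = A a a - c * A a b - cnj c * A b a + cnj c * c * A b b" for c
    using ab by (simp only: kapp_diff kapp_scale kinner_diff_left kinner_diff_right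
        kinner_scale_left kinner_scale_right k i) (simp add: algebra_simps)
  have p: "Im (kinner I v (kapp I A v)) = 0" for v
    using A by (simp add: psd_iff)
  have a0: "Im (A a a) = 0" "Im (A b b) = 0"
    using p[of "e a"] p[of "e b"] ab by (simp_all add: k i)
  have "Im (A a b) + Im (A b a) = 0"
    using p[of "\<lambda>i. e a i - 1 * e b i"] unfolding q using a0 by simp
  moreover have "Re (A a b) = Re (A b a)"
    using p[of "\<lambda>i. e a i - \<i> * e b i"] unfolding q using a0 by simp
  ultimately show "A a b = cnj (A b a)"
    by (simp add: complex_eq_iff)
qed

text \<open>A nonnegative form is minimal at \<open>v\<close>, so its first variation vanishes
  there: a small move from \<open>v\<close> along - A v would make the form negative unless A v =
  0.\<close>

lemma psd_null_vector:
  assumes fin: "finite I" and A: "psd I A" and v: "kinner I v (kapp I A v) = 0" and a: "a \<in> I"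
  shows "kapp I A v a = 0"
proof -
  have h: "hermitian_on I A" using psd_hermitian[OF fin A] .
  define s where "s = kapp I A v"
  define n where "n = Re (kinner I s s)"
  define r where "r = Re (kinner I s (kapp I A s))"
  have n0: "n \<ge> 0" unfolding n_def kinner_self by (simp add: sum_nonneg)
  have r0: "r \<ge> 0" using A unfolding r_def psd_iff by blast
  \<comment> \<open>The form at v - t s is - 2 t n + t^2 r. This \<open>t\<close> gives n = t (r +
    1), which turns the form into - t^2 (r + 2); the added 1 covers r = 0.\<close>
  define t where "t = n / (r + 1)"
  have vs: "kinner I v s = 0" "kinner I v (kapp I A s) = kinner I s s"
    using v by (simp_all add: s_def hermitian_adjoint[OF h, of v])
  have "kinner I (\<lambda>a. v a - of_real t * s a) (kapp I A (\<lambda>a. v a - of_real t * s a))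
     = - 2 * of_real t * kinner I s s + of_real (t\<^sup>2) * kinner I s (kapp I A s)"
    unfolding kapp_diff kapp_scale kinner_diff_left kinner_diff_right
        kinner_scale_left kinner_scale_right s_def[symmetric] vs
    by (simp add: algebra_simps power2_eq_square)
  moreover have "Re (kinner I (\<lambda>a. v a - of_real t * s a) (kapp I A (\<lambda>a. v a - of_real t * s a))) \<ge> 0"
    using A unfolding psd_iff by blast
  ultimately have "0 \<le> - 2 * t * n + t\<^sup>2 * r"
    by (simp add: n_def r_def)
  also have "\<dots> = - (t\<^sup>2 * (r + 2))"
  proof -
    have "n = t * (r + 1)" using r0 by (simp add: t_def)
    thus ?thesis by (simp add: algebra_simps power2_eq_square)
  qed
  finally have "t\<^sup>2 * (r + 2) \<le> 0" by simp
  hence "t = 0"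
    using r0 by (smt (verit) mult_pos_pos zero_less_power2)
  hence "n = 0" using r0 by (simp add: t_def)
  hence "kinner I s s = 0"
    unfolding n_def kinner_self by simp
  from kinner_self_eq_0[OF fin this a] show ?thesis by (simp add: s_def)
qed

lemma hermitian_quadratic_real:
  assumes "hermitian_on I A"
  shows "Im (kinner I v (kapp I A v)) = 0"
  by (metis hermitian_adjoint[OF assms] kinner_cnj cnj.simps(2) neg_equal_zero)

lemma kapp_shift:
  assumes "finite I" "a \<in> I"
  shows "kapp I (\<lambda>a b. A a b - (if a = b then c else 0)) v a = kapp I A v a - c * v a"
  using assms by (simp add: kapp_def left_diff_distrib sum_subtractf if_distrib[of "\<lambda>x. x * _"] cong: if_cong)

text \<open>The minimum of the Rayleigh quotient is attained by compactness of the unit sphere, here as a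
  closed subset of a product of discs that degenerate to a point outside \<open>I\<close>.\<close>

lemma hermitian_least_eigenvector:
  fixes A :: "'i \<Rightarrow> 'i \<Rightarrow> complex"
  assumes fin: "finite I" and ne: "I \<noteq> {}" and h: "hermitian_on I A"
  obtains \<mu> :: real and v where "kinner I v v = 1"
    "\<And>a. a \<in> I \<Longrightarrow> kapp I A v a = of_real \<mu> * v a"
    "psd I (\<lambda>a b. A a b - (if a = b then of_real \<mu> else 0))"
proof -
  define D where "D = PiE UNIV (\<lambda>i. if i \<in> I then cball 0 1 else {0::complex})"
  define S where "S = D \<inter> {v. (\<Sum>a\<in>I. (cmod (v a))\<^sup>2) = 1}"
  define q where "q = (\<lambda>v. Re (kinner I v (kapp I A v)))"
  \<comment> \<open>The index type may be infinite, so compactness comes from Tychonoff's theorem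
    for the product of the factors.\<close>
  have cD: "compact D"
    unfolding D_def compactin_euclidean_iff[symmetric] euclidean_product_topology[symmetric]
    by (subst compactin_PiE) auto
  have coord: "continuous_on UNIV (\<lambda>v::'i \<Rightarrow> complex. v a)" for a
    by (rule continuous_on_product_coordinates)
  have cS: "compact S"
    unfolding S_def
    by (intro compact_Int_closed[OF cD] closed_Collect_eq continuous_intros coord)
  have cq: "continuous_on S q"
    unfolding q_def kinner_def kapp_def
    by (intro continuous_intros continuous_on_subset[OF coord] subset_UNIV)
  obtain i where i: "i \<in> I" using ne by auto
  have "(\<lambda>a. if a = i then 1 else 0) \<in> S"
    using i fin by (auto simp: S_def D_def if_distrib[of cmod] if_distrib[of "\<lambda>x. x\<^sup>2"] cong: if_cong)
  hence "S \<noteq> {}" by auto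
  from continuous_attains_inf[OF cS this cq] obtain v where
    v: "v \<in> S" and vmin: "\<And>w. w \<in> S \<Longrightarrow> q v \<le> q w" by blast
  have vv: "kinner I v v = 1" using v by (simp add: kinner_self S_def)
  define \<mu> where "\<mu> = q v"
  let ?K = "\<lambda>a b. A a b - (if a = b then of_real \<mu> else 0)"
  have K: "kinner I w (kapp I ?K w) = kinner I w (kapp I A w) - of_real \<mu> * kinner I w w" for w
    unfolding kinner_scale_right[symmetric] kinner_diff_right[symmetric]
    using kapp_shift[OF fin] by (intro kinner_cong) auto
  have psd: "psd I ?K"
    unfolding psd_iff
  proof (intro allI conjI)
    fix w
    show "Im (kinner I w (kapp I ?K w)) = 0"
      unfolding K by (simp add: hermitian_quadratic_real[OF h] kinner_self)
    define n where "n = sqrt (\<Sum>a\<in>I. (cmod (w a))\<^sup>2)"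
    have nsq: "n\<^sup>2 = (\<Sum>a\<in>I. (cmod (w a))\<^sup>2)"
      unfolding n_def by (intro real_sqrt_pow2 sum_nonneg) auto
    have n0: "n \<ge> 0" unfolding n_def by (simp add: sum_nonneg)
    show "0 \<le> Re (kinner I w (kapp I ?K w))"
    proof (cases "n = 0")
      case True
      hence "\<And>a. a \<in> I \<Longrightarrow> w a = 0"
        using nsq fin by (simp add: sum_nonneg_eq_0_iff)
      thus ?thesis by (simp add: kinner_def)
    next
      case False
      hence n1: "n > 0" using n0 by simp
      \<comment> \<open>Points of \<open>S\<close> vanish outside \<open>I\<close>, so the
        normalized vector is cut off there.\<close>
      define z where "z = (\<lambda>a. if a \<in> I then of_real (1/n) * w a else 0)"
      have zs: "(\<Sum>a\<in>I. (cmod (z a))\<^sup>2) = 1"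
      proof -
        have "(\<Sum>a\<in>I. (cmod (z a))\<^sup>2) = (\<Sum>a\<in>I. (cmod (w a))\<^sup>2 / n\<^sup>2)"
          using n1 by (intro sum.cong) (simp_all add: z_def norm_mult norm_divide power_divide)
        thus ?thesis using n1 by (simp add: sum_divide_distrib[symmetric] nsq[symmetric])
      qed
      have "cmod (z a) \<le> 1" if "a \<in> I" for a
      proof -
        have "(cmod (z a))\<^sup>2 \<le> 1"
          using member_le_sum[of a I "\<lambda>a. (cmod (z a))\<^sup>2"] that fin zs by simp
        thus ?thesis by (simp add: power_le_one_iff abs_square_le_1)
      qed
      hence "z \<in> S" using zs by (auto simp: S_def D_def z_def)
      from vmin[OF this] have "\<mu> \<le> q z" by (simp add: \<mu>_def)
      also have "q z = q (\<lambda>a. of_real (1/n) * w a)"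
      proof -
        have "kapp I A z = kapp I A (\<lambda>a. of_real (1/n) * w a)"
          by (intro kapp_cong) (simp add: z_def)
        thus ?thesis unfolding q_def by (simp add: z_def cong: kinner_cong)
      qed
      also have "\<dots> = q w / n\<^sup>2"
        unfolding q_def kapp_scale kinner_scale_left kinner_scale_right
        by (simp add: power2_eq_square)
      finally have "\<mu> * n\<^sup>2 \<le> q w" using n1 by (simp add: field_simps)
      thus ?thesis unfolding K by (simp add: kinner_self q_def nsq)
    qed
  qed
  \<comment> \<open>The minimizer is a null vector of the positive kernel A - \<open>\<mu>\<close>,
    hence is killed by it: this is the eigenvalue equation.\<close>
  have "kinner I v (kapp I ?K v) = 0"
    unfolding K vv by (simp add: complex_eq_iff \<mu>_def q_def hermitian_quadratic_real[OF h])
  note null = psd_null_vector[OF fin psd this]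
  have "kapp I A v a = of_real \<mu> * v a" if "a \<in> I" for a
    using null[OF that] unfolding kapp_shift[OF fin that] by simp
  thus ?thesis using that vv psd by blast
qed

text \<open>If \<open>A (B v) = \<mu> v\<close> with \<open>\<mu> < 0\<close>, then \<open>\<langle>B v, A (B v)\<rangle> = \<mu> \<langle>B v, v\<rangle>\<close> forces \<open>\<langle>B v, v\<rangle> = 0\<close>,
  hence \<open>B v = 0\<close> and \<open>v = 0\<close>.\<close>

lemma psd_kmult:
  assumes fin: "finite I" and A: "psd I A" and B: "psd I B" and h: "hermitian_on I (kmult I A B)"
  shows "psd I (kmult I A B)"
proof (cases "I = {}")
  case True
  thus ?thesis by (simp add: psd_def)
next
  case False
  from hermitian_least_eigenvector[OF fin False h] obtain \<mu> :: real and v where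
    vv: "kinner I v v = 1" and ev: "\<And>a. a \<in> I \<Longrightarrow> kapp I A (kapp I B v) a = of_real \<mu> * v a"
    and K: "psd I (\<lambda>a b. kmult I A B a b - (if a = b then of_real \<mu> else 0))"
    unfolding kapp_kmult by blast
  have hB: "hermitian_on I B" using psd_hermitian[OF fin B] .
  have \<mu>: "\<mu> \<ge> 0"
  proof (rule ccontr)
    assume "\<not> \<mu> \<ge> 0"
    have "kinner I (kapp I B v) (kapp I A (kapp I B v)) = of_real \<mu> * kinner I (kapp I B v) v"
      unfolding kinner_scale_right[symmetric] using ev by (intro kinner_cong) auto
    also have "\<dots> = of_real \<mu> * kinner I v (kapp I B v)"
      by (simp add: hermitian_adjoint[OF hB])
    finally have "0 \<le> \<mu> * Re (kinner I v (kapp I B v))"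
      using A unfolding psd_iff by (metis Re_complex_of_real Im_complex_of_real times_complex.simps(1) mult_zero_left diff_zero)
    moreover have "0 \<le> Re (kinner I v (kapp I B v))" "Im (kinner I v (kapp I B v)) = 0"
      using B unfolding psd_iff by auto
    ultimately have "kinner I v (kapp I B v) = 0"
      using \<open>\<not> \<mu> \<ge> 0\<close> by (simp add: complex_eq_iff zero_le_mult_iff)
    from psd_null_vector[OF fin B this] have "kapp I A (kapp I B v) = kapp I A (\<lambda>_. 0)"
      by (intro kapp_cong) auto
    hence "kapp I A (kapp I B v) a = 0" for a
      by (simp add: kapp_def)
    hence "v a = 0" if "a \<in> I" for a
      using ev[OF that] \<open>\<not> \<mu> \<ge> 0\<close> by simp
    hence "kinner I v v = 0" by (simp add: kinner_def)
    thus False using vv by simp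
  qed
  show ?thesis
    unfolding psd_iff
  proof (intro allI conjI)
    fix w
    show "Im (kinner I w (kapp I (kmult I A B) w)) = 0"
      using h by (rule hermitian_quadratic_real)
    have K_eq: "kinner I w (kapp I (\<lambda>a b. kmult I A B a b - (if a = b then of_real \<mu> else 0)) w)
      = kinner I w (kapp I (kmult I A B) w) - of_real \<mu> * kinner I w w"
      unfolding kinner_scale_right[symmetric] kinner_diff_right[symmetric]
      using kapp_shift[OF fin] by (intro kinner_cong) auto
    have "0 \<le> Re (kinner I w (kapp I (kmult I A B) w) - of_real \<mu> * kinner I w w)"
      unfolding K_eq[symmetric] using K unfolding psd_iff by blast
    hence "\<mu> * Re (kinner I w w) \<le> Re (kinner I w (kapp I (kmult I A B) w))"
      by simp
    moreover have "0 \<le> \<mu> * Re (kinner I w w)"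
      using \<mu> by (simp add: kinner_self sum_nonneg)
    ultimately show "0 \<le> Re (kinner I w (kapp I (kmult I A B) w))"
      by linarith
  qed
qed

lemma hermitian_kmult:
  assumes A: "hermitian_on I A" and B: "hermitian_on I B"
    and comm: "\<And>a b. a \<in> I \<Longrightarrow> b \<in> I \<Longrightarrow> kmult I A B a b = kmult I B A a b"
  shows "hermitian_on I (kmult I A B)"
  unfolding hermitian_on_def
proof (intro ballI)
  fix a b assume ab: "a \<in> I" "b \<in> I"
  have "kmult I A B a b = (\<Sum>c\<in>I. cnj (A c a) * cnj (B b c))"
    unfolding kmult_def using A B ab unfolding hermitian_on_def by (intro sum.cong refl) metis
  also have "\<dots> = cnj (kmult I B A b a)"
    by (simp add: kmult_def mult.commute)
  finally show "kmult I A B a b = cnj (kmult I A B b a)"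
    using comm ab by simp
qed

section \<open>Compression, amplification and rescaling of positive kernels\<close>

lemma sum_Times: "(\<Sum>s\<in>I \<times> J. f s) = (\<Sum>a\<in>I. \<Sum>x\<in>J. f (a, x))"
  by (simp add: sum.cartesian_product)

text \<open>The form is tested on product vectors u (x) v with \<open>u\<close> fixed. With
  \<open>u\<close> the vector of dimensions this lowers the tensor power of T_n; with
  \<open>u\<close> the basis vector at 0 it extracts \<Delta>.\<close>

lemma psd_compress:
  fixes A :: "'i \<times> 'j \<Rightarrow> 'i \<times> 'j \<Rightarrow> complex"
  assumes A: "psd (I \<times> J) A"
  shows "psd J (\<lambda>x y. \<Sum>a\<in>I. \<Sum>b\<in>I. cnj (u a) * A (a, x) (b, y) * u b)"
  unfolding psd_def Let_def
proof
  fix v :: "'j \<Rightarrow> complex"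
  define w where "w = (\<lambda>(a, x). u a * v x)"
  have "(\<Sum>s\<in>I \<times> J. \<Sum>t\<in>I \<times> J. cnj (w s) * A s t * w t)
     = (\<Sum>a\<in>I. \<Sum>x\<in>J. \<Sum>b\<in>I. \<Sum>y\<in>J. cnj (w (a, x)) * A (a, x) (b, y) * w (b, y))"
    by (simp only: sum_Times)
  also have "\<dots> = (\<Sum>a\<in>I. \<Sum>x\<in>J. \<Sum>y\<in>J. \<Sum>b\<in>I. cnj (w (a, x)) * A (a, x) (b, y) * w (b, y))"
    by (intro sum.cong refl sum.swap)
  also have "\<dots> = (\<Sum>x\<in>J. \<Sum>a\<in>I. \<Sum>y\<in>J. \<Sum>b\<in>I. cnj (w (a, x)) * A (a, x) (b, y) * w (b, y))"
    by (rule sum.swap)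
  also have "\<dots> = (\<Sum>x\<in>J. \<Sum>y\<in>J. \<Sum>a\<in>I. \<Sum>b\<in>I. cnj (w (a, x)) * A (a, x) (b, y) * w (b, y))"
    by (intro sum.cong refl sum.swap)
  also have "\<dots> = (\<Sum>x\<in>J. \<Sum>y\<in>J. cnj (v x) * (\<Sum>a\<in>I. \<Sum>b\<in>I. cnj (u a) * A (a, x) (b, y) * u b) * v y)"
    by (simp add: w_def sum_distrib_left sum_distrib_right mult_ac)
  finally show "Im (\<Sum>x\<in>J. \<Sum>y\<in>J. cnj (v x) * (\<Sum>a\<in>I. \<Sum>b\<in>I. cnj (u a) * A (a, x) (b, y) * u b) * v y) = 0 \<and>
      0 \<le> Re (\<Sum>x\<in>J. \<Sum>y\<in>J. cnj (v x) * (\<Sum>a\<in>I. \<Sum>b\<in>I. cnj (u a) * A (a, x) (b, y) * u b) * v y)"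
    using A unfolding psd_def Let_def by metis
qed

text \<open>The form splits into one copy of the form of \<open>A\<close> for each slice of the
  vector at a fixed element of \<open>J\<close>.\<close>

lemma psd_tensor_id:
  fixes A :: "'i \<Rightarrow> 'i \<Rightarrow> complex" and J :: "'j set"
  assumes fin: "finite J" and A: "psd I A"
  shows "psd (I \<times> J) (\<lambda>(a, x) (b, y). if x = y then A a b else 0)"
  unfolding psd_def Let_def
proof
  fix v :: "'i \<times> 'j \<Rightarrow> complex"
  define q where "q = (\<lambda>w. \<Sum>a\<in>I. \<Sum>b\<in>I. cnj (w a) * A a b * w b)"
  have "(\<Sum>s\<in>I \<times> J. \<Sum>t\<in>I \<times> J. cnj (v s) * (case s of (a, x) \<Rightarrow> \<lambda>(b, y). if x = y then A a b else 0) t * v t)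
     = (\<Sum>a\<in>I. \<Sum>x\<in>J. \<Sum>b\<in>I. \<Sum>y\<in>J. if x = y then cnj (v (a, x)) * A a b * v (b, y) else 0)"
    by (simp add: sum_Times if_distrib[of "\<lambda>x. _ * x"] if_distrib[of "\<lambda>x. x * _"] cong: if_cong)
  also have "\<dots> = (\<Sum>a\<in>I. \<Sum>x\<in>J. \<Sum>b\<in>I. cnj (v (a, x)) * A a b * v (b, x))"
    using fin by simp
  also have "\<dots> = (\<Sum>x\<in>J. q (\<lambda>a. v (a, x)))"
    unfolding q_def by (rule sum.swap)
  finally have eq: "(\<Sum>s\<in>I \<times> J. \<Sum>t\<in>I \<times> J. cnj (v s) * (case s of (a, x) \<Rightarrow> \<lambda>(b, y). if x = y then A a b else 0) t * v t) = (\<Sum>x\<in>J. q (\<lambda>a. v (a, x)))" .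
  have "Im (q w) = 0 \<and> 0 \<le> Re (q w)" for w
    using A unfolding psd_def Let_def q_def by blast
  thus "Im (\<Sum>s\<in>I \<times> J. \<Sum>t\<in>I \<times> J. cnj (v s) * (case s of (a, x) \<Rightarrow> \<lambda>(b, y). if x = y then A a b else 0) t * v t) = 0
    \<and> 0 \<le> Re (\<Sum>s\<in>I \<times> J. \<Sum>t\<in>I \<times> J. cnj (v s) * (case s of (a, x) \<Rightarrow> \<lambda>(b, y). if x = y then A a b else 0) t * v t)"
    unfolding eq by (simp add: sum_nonneg)
qed

lemma psd_scale_cancel:
  assumes "psd I (\<lambda>a b. of_real c * A a b)" "c > 0"
  shows "psd I A"
proof -
  have "(\<Sum>a\<in>I. \<Sum>b\<in>I. cnj (v a) * (of_real c * A a b) * v b)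
    = of_real c * (\<Sum>a\<in>I. \<Sum>b\<in>I. cnj (v a) * A a b * v b)" for v
    by (simp add: sum_distrib_left mult_ac)
  thus ?thesis
    using assms by (simp add: psd_def Let_def zero_le_mult_iff)
qed

section \<open>A Perron--Frobenius theorem for symmetric matrices\<close>

text \<open>Take a least eigenvector of -A. As the entries of \<open>A\<close> are positive, passing
  to absolute values keeps the norm and does not raise the form of -A, so the result is again a
  minimizer. If an eigenvector for the least eigenvalue vanishes at one place, the equation for its
  absolute values at that place makes it vanish everywhere; this yields strict positivity and
  simplicity.\<close>

lemma symmetric_Perron_Frobenius:
  fixes A :: "'i \<Rightarrow> 'i \<Rightarrow> real"
  assumes fin: "finite I" and ne: "I \<noteq> {}"
    and sym: "\<And>a b. a \<in> I \<Longrightarrow> b \<in> I \<Longrightarrow> A a b = A b a"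
    and pos: "\<And>a b. a \<in> I \<Longrightarrow> b \<in> I \<Longrightarrow> 0 < A a b"
  shows "\<exists>\<rho> v. (\<forall>a\<in>I. 0 < v a) \<and> (\<forall>a\<in>I. (\<Sum>b\<in>I. A a b * v b) = \<rho> * v a) \<and>
    (\<forall>w. (\<forall>a\<in>I. (\<Sum>b\<in>I. A a b * w b) = \<rho> * w a) \<longrightarrow> (\<exists>t. \<forall>a\<in>I. w a = t * v a))"
proof -
  let ?H = "\<lambda>a b. - complex_of_real (A a b)"
  have h: "hermitian_on I ?H"
    unfolding hermitian_on_def using sym by simp
  from hermitian_least_eigenvector[OF fin ne h] obtain \<mu> :: real and z where
    zz: "kinner I z z = 1" and ev: "\<And>a. a \<in> I \<Longrightarrow> kapp I ?H z a = of_real \<mu> * z a"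
    and K: "psd I (\<lambda>a b. ?H a b - (if a = b then of_real \<mu> else 0))" (is "psd I ?K")
    by blast
  define eig where "eig = (\<lambda>z. \<forall>a\<in>I. kapp I ?H z a = of_real \<mu> * z a)"
  have Kz: "kinner I w (kapp I ?K w) = kinner I w (kapp I ?H w) - of_real \<mu> * kinner I w w" for w
    unfolding kinner_scale_right[symmetric] kinner_diff_right[symmetric]
    using kapp_shift[OF fin] by (intro kinner_cong) auto
  have eig_abs: "eig (\<lambda>a. of_real (cmod (z a)))" if z: "eig z" for z
  proof -
    let ?y = "\<lambda>a. complex_of_real (cmod (z a))"
    have Hz: "kinner I z (kapp I ?H z) = of_real \<mu> * kinner I z z"
      unfolding kinner_scale_right[symmetric] using z by (intro kinner_cong) (auto simp: eig_def)
    have yy: "kinner I ?y ?y = kinner I z z" by (simp add: kinner_self)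
    have "Re (kinner I ?y (kapp I ?H ?y)) = - (\<Sum>a\<in>I. \<Sum>b\<in>I. cmod (z a) * (A a b * cmod (z b)))"
      by (simp add: kinner_def kapp_def sum_distrib_left sum_negf)
    also have "\<dots> \<le> Re (kinner I z (kapp I ?H z))"
    proof -
      have "- Re (kinner I z (kapp I ?H z)) \<le> cmod (kinner I z (kapp I ?H z))"
        using abs_Re_le_cmod[of "kinner I z (kapp I ?H z)"] by linarith
      also have "\<dots> \<le> (\<Sum>a\<in>I. cmod (cnj (z a) * kapp I ?H z a))"
        unfolding kinner_def by (rule norm_sum)
      also have "\<dots> \<le> (\<Sum>a\<in>I. \<Sum>b\<in>I. cmod (z a) * (A a b * cmod (z b)))"
      proof (rule sum_mono)
        fix a assume a: "a \<in> I"
        have "cmod (kapp I ?H z a) \<le> (\<Sum>b\<in>I. cmod (?H a b * z b))"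
          unfolding kapp_def by (rule norm_sum)
        also have "\<dots> = (\<Sum>b\<in>I. A a b * cmod (z b))"
          using pos[OF a] by (intro sum.cong refl) (simp add: norm_mult less_imp_le)
        finally show "cmod (cnj (z a) * kapp I ?H z a) \<le> (\<Sum>b\<in>I. cmod (z a) * (A a b * cmod (z b)))"
          by (simp add: norm_mult sum_distrib_left[symmetric] mult_left_mono)
      qed
      finally show ?thesis by simp
    qed
    finally have "Re (kinner I ?y (kapp I ?K ?y)) \<le> 0"
      unfolding Kz yy Hz by simp
    hence "kinner I ?y (kapp I ?K ?y) = 0"
      using K unfolding psd_iff by (simp add: complex_eq_iff order_antisym)
    note null = psd_null_vector[OF fin K this]
    show ?thesis
      unfolding eig_def
    proof
      fix a assume a: "a \<in> I"
      show "kapp I ?H ?y a = of_real \<mu> * ?y a"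
        using null[OF a] unfolding kapp_shift[OF fin a] by simp
    qed
  qed
  have eig_0: "z b = 0" if z: "eig z" and a: "a \<in> I" "z a = 0" and b: "b \<in> I" for z a b
  proof -
    have "kapp I ?H (\<lambda>a. of_real (cmod (z a))) a = 0"
      using eig_abs[OF z] a unfolding eig_def by simp
    hence "complex_of_real (\<Sum>b\<in>I. A a b * cmod (z b)) = 0"
      by (simp add: kapp_def sum_negf)
    hence "(\<Sum>b\<in>I. A a b * cmod (z b)) = 0"
      unfolding of_real_eq_0_iff .
    moreover have "\<And>b. b \<in> I \<Longrightarrow> 0 \<le> A a b * cmod (z b)"
      using pos[OF a(1)] by (simp add: less_imp_le)
    ultimately have "A a b * cmod (z b) = 0"
      using b fin by (simp add: sum_nonneg_eq_0_iff)
    thus ?thesis using pos[OF a(1) b] by simp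
  qed
  have eig_real: "eig (\<lambda>a. of_real (w a)) \<longleftrightarrow> (\<forall>a\<in>I. (\<Sum>b\<in>I. A a b * w b) = - \<mu> * w a)" for w
  proof -
    have "kapp I ?H (\<lambda>a. of_real (w a)) a = - of_real (\<Sum>b\<in>I. A a b * w b)" for a
      by (simp add: kapp_def sum_negf)
    hence "kapp I ?H (\<lambda>a. of_real (w a)) a = of_real \<mu> * of_real (w a) \<longleftrightarrow>
        (\<Sum>b\<in>I. A a b * w b) = - \<mu> * w a" for a
      by (metis (no_types, lifting) minus_equation_iff mult_minus_left of_real_eq_iff of_real_minus of_real_mult)
    thus ?thesis by (simp add: eig_def)
  qed
  have z: "eig z" using ev by (simp add: eig_def)
  define v where "v = (\<lambda>a. cmod (z a))"
  have v: "eig (\<lambda>a. of_real (v a))" using eig_abs[OF z] by (simp add: v_def)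
  have v0: "v a > 0" if a: "a \<in> I" for a
  proof (rule ccontr)
    assume "\<not> v a > 0"
    hence "z a = 0" by (simp add: v_def)
    from eig_0[OF z a this] have "kinner I z z = 0" by (simp add: kinner_def)
    thus False using zz by simp
  qed
  have "\<exists>t. \<forall>a\<in>I. w a = t * v a" if w: "\<And>a. a \<in> I \<Longrightarrow> (\<Sum>b\<in>I. A a b * w b) = - \<mu> * w a" for w
  proof -
    obtain i where i: "i \<in> I" using ne by auto
    \<comment> \<open>This multiple makes w - t v vanish at \<open>i\<close>, hence everywhere by
      \<open>eig_0\<close>.\<close>
    define t where "t = w i / v i"
    have "eig (\<lambda>a. of_real (w a - t * v a))"
      unfolding eig_real using w v[unfolded eig_real]
      by (simp add: algebra_simps sum_subtractf sum_distrib_left[symmetric])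
    moreover have "w i - t * v i = 0" using v0[OF i] by (simp add: t_def)
    ultimately have "w a - t * v a = 0" if "a \<in> I" for a
      using eig_0[of "\<lambda>a. of_real (w a - t * v a)" i a] i that by (metis of_real_0 of_real_eq_0_iff)
    thus ?thesis by (intro exI[of _ t]) simp
  qed
  thus ?thesis
    using v0 v[unfolded eig_real] by (intro exI[of _ "- \<mu>"] exI[of _ v]) simp
qed

section \<open>The dimension character of a fusion ring\<close>

locale fusion =
  fixes m :: nat and N :: "nat \<Rightarrow> nat \<Rightarrow> nat \<Rightarrow> nat" and dual :: "nat \<Rightarrow> nat"
  assumes fusion: "fusion_ring m N dual"
begin

section \<open>The axioms and the symmetries of the structure constants\<close>

lemma m_pos: "0 < m"
  using fusion[unfolded fusion_ring_def, THEN conjunct1] by simp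

lemma dual_less [simp]: "i < m \<Longrightarrow> dual i < m"
  by (rule fusion[unfolded fusion_ring_def, THEN conjunct2, THEN conjunct1, rule_format, THEN conjunct1])

lemma dual_dual [simp]: "i < m \<Longrightarrow> dual (dual i) = i"
  by (rule fusion[unfolded fusion_ring_def, THEN conjunct2, THEN conjunct1, rule_format, THEN conjunct2])

lemma N_unit_left: "i < m \<Longrightarrow> k < m \<Longrightarrow> N 0 i k = (if i = k then 1 else 0)"
  by (rule fusion[unfolded fusion_ring_def, THEN conjunct2, THEN conjunct2, THEN conjunct1, rule_format, THEN conjunct1])

lemma N_unit_right: "i < m \<Longrightarrow> k < m \<Longrightarrow> N i 0 k = (if i = k then 1 else 0)"
  by (rule fusion[unfolded fusion_ring_def, THEN conjunct2, THEN conjunct2, THEN conjunct1, rule_format, THEN conjunct2])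

lemma N_assoc:
  "i < m \<Longrightarrow> j < m \<Longrightarrow> k < m \<Longrightarrow> p < m \<Longrightarrow>
    (\<Sum>l<m. N i j l * N l k p) = (\<Sum>l<m. N j k l * N i l p)"
  by (rule fusion[unfolded fusion_ring_def, THEN conjunct2, THEN conjunct2, THEN conjunct2, THEN conjunct1, rule_format])

lemma N_dual: "i < m \<Longrightarrow> j < m \<Longrightarrow> k < m \<Longrightarrow> N (dual j) (dual i) (dual k) = N i j k"
  by (rule fusion[unfolded fusion_ring_def, THEN conjunct2, THEN conjunct2, THEN conjunct2, THEN conjunct2, THEN conjunct1, rule_format])

lemma N_0: "i < m \<Longrightarrow> j < m \<Longrightarrow> N i j 0 = (if i = dual j then 1 else 0)"
  by (rule fusion[unfolded fusion_ring_def, THEN conjunct2, THEN conjunct2, THEN conjunct2, THEN conjunct2, THEN conjunct2, rule_format])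

lemma dual_0: "dual 0 = 0"
proof -
  have "N 0 0 0 = 1" using m_pos by (simp add: N_unit_left)
  thus ?thesis unfolding N_0[OF m_pos m_pos] by (metis zero_neq_one)
qed

lemma bij_dual: "bij_betw dual {..<m} {..<m}"
  by (rule bij_betwI[where g = dual]) auto

lemma sum_dual: "(\<Sum>i<m. f (dual i)) = (\<Sum>i<m. f i)"
  by (rule sum.reindex_bij_betw[OF bij_dual])

text \<open>By associativity the coefficient of 1 in x_i x_j x_k can be computed with either
  bracketing.\<close>

lemma N_cyclic:
  assumes "i < m" "j < m" "k < m"
  shows "N i j (dual k) = N j k (dual i)"
proof -
  have "(\<Sum>l<m. N i j l * N l k 0) = (\<Sum>l<m. if l = dual k then N i j l else 0)"
    using assms by (intro sum.cong) (auto simp: N_0)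
  moreover have "(\<Sum>l<m. N j k l * N i l 0) = (\<Sum>l<m. if l = dual i then N j k l else 0)"
    using assms by (intro sum.cong) (auto simp: N_0)
  ultimately show ?thesis
    using N_assoc[of i j k 0] assms m_pos by simp
qed

text \<open>The involution followed by two cyclic rotations. In matrix form: passing to the dual
  basis element transposes the fusion matrix.\<close>

lemma N_transpose:
  assumes "i < m" "j < m" "k < m"
  shows "N (dual j) k i = N j i k"
proof -
  have "N (dual j) k i = N (dual j) (dual (dual k)) (dual (dual i))" using assms by simp
  also have "\<dots> = N (dual k) j (dual i)" using assms by (intro N_dual) auto
  also have "\<dots> = N i (dual k) (dual j)" using assms by (intro N_cyclic[symmetric]) auto
  also have "\<dots> = N j i (dual (dual k))" using assms by (intro N_cyclic[symmetric]) auto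
  finally show ?thesis using assms by simp
qed

text \<open>The counterpart of \<open>N_transpose\<close> for right multiplication; it makes the sum
  of all right multiplications symmetric.\<close>

lemma N_right:
  assumes "i < m" "j < m" "k < m"
  shows "N k (dual i) j = N j i k"
proof -
  have "N k (dual i) j = N (dual (dual k)) (dual i) (dual (dual j))" using assms by simp
  also have "\<dots> = N i (dual k) (dual j)" using assms by (intro N_dual) auto
  also have "\<dots> = N j i (dual (dual k))" using assms by (intro N_cyclic[symmetric]) auto
  finally show ?thesis using assms by simp
qed

text \<open>The product x_i x_{i*} contains 1, so x_i x_{i*} x_k contains x_k. By associativity some
  x_j in x_{i*} x_k then has x_k in x_i x_j.\<close>

lemma right_mult_sum_pos:
  assumes "i < m" "k < m"
  shows "0 < (\<Sum>j<m. N i j k)"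
proof (rule ccontr)
  assume "\<not> 0 < (\<Sum>j<m. N i j k)"
  hence "\<And>j. j < m \<Longrightarrow> N i j k = 0" by simp
  hence "\<And>j. j < m \<Longrightarrow> N (dual i) k j = 0" using N_transpose assms by simp
  hence "(\<Sum>l<m. N i (dual i) l * N l k k) = 0" using N_assoc[of i "dual i" k k] assms by simp
  hence "N i (dual i) 0 * N 0 k k = 0" using m_pos by simp
  thus False using assms by (simp add: N_0 N_unit_left)
qed

text \<open>Right multiplication by \<open>\<Sum>j. x\<^sub>j\<close> is symmetric with positive entries and commutes with all
  left multiplications, so its Perron--Frobenius vector is a common eigenvector of the latter.\<close>

lemma positive_common_eigenvector:
  obtains v e where "\<And>i. i < m \<Longrightarrow> 0 < v i"
    "\<And>j k. j < m \<Longrightarrow> k < m \<Longrightarrow> (\<Sum>i<m. real (N j i k) * v i) = e j * v k"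
proof -
  define A where "A = (\<lambda>k i. \<Sum>j<m. real (N i j k))"
  have sym: "A k i = A i k" if "i \<in> {..<m}" "k \<in> {..<m}" for i k
  proof -
    have "A k i = (\<Sum>j<m. real (N k (dual j) i))"
      unfolding A_def using that by (intro sum.cong) (simp_all add: N_right)
    also have "\<dots> = A i k"
      unfolding A_def by (rule sum_dual)
    finally show ?thesis .
  qed
  have pos: "0 < A k i" if "i \<in> {..<m}" "k \<in> {..<m}" for i k
    using right_mult_sum_pos[of i k] that unfolding A_def
    by (simp only: of_nat_sum[symmetric] of_nat_0_less_iff lessThan_iff)
  have ne: "{..<m} \<noteq> {}" using m_pos by auto
  have "\<exists>\<rho> v. (\<forall>k\<in>{..<m}. 0 < v k) \<and> (\<forall>k\<in>{..<m}. (\<Sum>i<m. A k i * v i) = \<rho> * v k) \<and>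
      (\<forall>w. (\<forall>k\<in>{..<m}. (\<Sum>i<m. A k i * w i) = \<rho> * w k) \<longrightarrow> (\<exists>t. \<forall>k\<in>{..<m}. w k = t * v k))"
    by (rule symmetric_Perron_Frobenius[OF finite_lessThan ne]; (rule sym | rule pos); assumption)
  then obtain \<rho> v where PF: "(\<forall>k\<in>{..<m}. 0 < v k) \<and> (\<forall>k\<in>{..<m}. (\<Sum>i<m. A k i * v i) = \<rho> * v k) \<and>
      (\<forall>w. (\<forall>k\<in>{..<m}. (\<Sum>i<m. A k i * w i) = \<rho> * w k) \<longrightarrow> (\<exists>t. \<forall>k\<in>{..<m}. w k = t * v k))"
    by (elim exE)
  note v = PF[THEN conjunct1] and ev' = PF[THEN conjunct2, THEN conjunct1]
    and simple = PF[THEN conjunct2, THEN conjunct2]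
  have ev: "(\<Sum>i<m. A k i * v i) = \<rho> * v k" if "k < m" for k
    using ev' that by simp
  \<comment> \<open>The \<open>\<rho>\<close>-eigenspace of \<open>A\<close> is a line. The chain
    below moves M_j past \<open>A\<close>, so M_j v lies in that line.\<close>
  have "\<exists>t. \<forall>k\<in>{..<m}. (\<Sum>i<m. real (N j i k) * v i) = t * v k" if j: "j < m" for j
  proof (rule simple[rule_format])
    fix k assume "k \<in> {..<m}"
    hence k: "k < m" by simp
    have assoc: "(\<Sum>l<m. real (N l r k) * real (N j i l)) = (\<Sum>l<m. real (N j l k) * real (N i r l))"
      if "r < m" "i < m" for r i
      using arg_cong[OF N_assoc[of j i r k], of real] that j k by (simp add: mult.commute)
    have "(\<Sum>l<m. A k l * (\<Sum>i<m. real (N j i l) * v i))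
        = (\<Sum>l<m. \<Sum>r<m. \<Sum>i<m. real (N l r k) * real (N j i l) * v i)"
      by (simp add: A_def sum_product mult.assoc)
    also have "\<dots> = (\<Sum>r<m. \<Sum>l<m. \<Sum>i<m. real (N l r k) * real (N j i l) * v i)"
      by (rule sum.swap)
    also have "\<dots> = (\<Sum>r<m. \<Sum>i<m. \<Sum>l<m. real (N l r k) * real (N j i l) * v i)"
      by (rule sum.cong[OF refl]) (rule sum.swap)
    also have "\<dots> = (\<Sum>r<m. \<Sum>i<m. \<Sum>l<m. real (N j l k) * real (N i r l) * v i)"
      unfolding sum_distrib_right[symmetric] by (simp add: assoc)
    also have "\<dots> = (\<Sum>r<m. \<Sum>l<m. \<Sum>i<m. real (N j l k) * real (N i r l) * v i)"
      by (rule sum.cong[OF refl]) (rule sum.swap)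
    also have "\<dots> = (\<Sum>l<m. \<Sum>r<m. \<Sum>i<m. real (N j l k) * real (N i r l) * v i)"
      by (rule sum.swap)
    also have "\<dots> = (\<Sum>l<m. real (N j l k) * (\<Sum>i<m. A l i * v i))"
    proof (intro sum.cong refl)
      fix l
      have "(\<Sum>r<m. \<Sum>i<m. real (N j l k) * real (N i r l) * v i)
          = (\<Sum>i<m. \<Sum>r<m. real (N j l k) * real (N i r l) * v i)"
        by (rule sum.swap)
      thus "(\<Sum>r<m. \<Sum>i<m. real (N j l k) * real (N i r l) * v i) = real (N j l k) * (\<Sum>i<m. A l i * v i)"
        by (simp add: A_def sum_distrib_left sum_distrib_right mult.assoc)
    qed
    also have "\<dots> = \<rho> * (\<Sum>i<m. real (N j i k) * v i)"
      by (simp add: ev) (simp add: sum_distrib_left mult_ac)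
    finally show "(\<Sum>l<m. A k l * (\<Sum>i<m. real (N j i l) * v i)) = \<rho> * (\<Sum>i<m. real (N j i k) * v i)" .
  qed
  hence "\<forall>j\<in>{..<m}. \<exists>t. \<forall>k\<in>{..<m}. (\<Sum>i<m. real (N j i k) * v i) = t * v k"
    by simp
  from bchoice[OF this] obtain e where
    "\<forall>j\<in>{..<m}. \<forall>k\<in>{..<m}. (\<Sum>i<m. real (N j i k) * v i) = e j * v k" ..
  thus ?thesis using that[of v e] v by simp
qed

text \<open>This is the Schur test: Cauchy--Schwarz is applied to each row with weights from \<open>v\<close>.\<close>

lemma opnorm_eqI:
  fixes B :: "nat \<Rightarrow> nat \<Rightarrow> real"
  assumes n: "0 < n" and v: "\<And>i. i < n \<Longrightarrow> 0 < v i" and B: "\<And>a b. 0 \<le> B a b" and e: "0 \<le> e"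
    and right: "\<And>a. a < n \<Longrightarrow> (\<Sum>b<n. B a b * v b) = e * v a"
    and left: "\<And>b. b < n \<Longrightarrow> (\<Sum>a<n. B a b * v a) = e * v b"
  shows "opnorm n (\<lambda>a b. of_real (B a b)) = e"
  unfolding opnorm_def
proof (rule cSup_eq_maximum)
  define s where "s = (\<Sum>b<n. (v b)\<^sup>2)"
  have s: "s > 0"
    unfolding s_def using n v by (intro sum_pos) (auto simp: less_imp_neq[symmetric])
  define w where "w = (\<lambda>b. complex_of_real (v b / sqrt s))"
  have ww: "(\<Sum>b<n. (cmod (w b))\<^sup>2) = 1"
    using s by (simp add: w_def norm_divide power_divide sum_divide_distrib[symmetric] s_def[symmetric])
  have "(\<Sum>b<n. of_real (B a b) * w b) = of_real e * w a" if "a < n" for a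
  proof -
    have "(\<Sum>b<n. of_real (B a b) * w b) = of_real ((\<Sum>b<n. B a b * v b) / sqrt s)"
      by (simp add: w_def sum_divide_distrib)
    thus ?thesis using right[OF that] by (simp add: w_def)
  qed
  hence "(\<Sum>a<n. (cmod (\<Sum>b<n. of_real (B a b) * w b))\<^sup>2) = e\<^sup>2"
    by (simp add: norm_mult power_mult_distrib sum_distrib_left[symmetric] ww)
  hence "e = sqrt (\<Sum>a<n. (cmod (\<Sum>b<n. of_real (B a b) * w b))\<^sup>2)" using e by simp
  thus "e \<in> {sqrt (\<Sum>a<n. (cmod (\<Sum>b<n. of_real (B a b) * v b))\<^sup>2) | v. (\<Sum>b<n. (cmod (v b))\<^sup>2) \<le> 1}"
    using ww by fastforce
next
  fix x assume "x \<in> {sqrt (\<Sum>a<n. (cmod (\<Sum>b<n. of_real (B a b) * v b))\<^sup>2) | v. (\<Sum>b<n. (cmod (v b))\<^sup>2) \<le> 1}"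
  then obtain w where x: "x = sqrt (\<Sum>a<n. (cmod (\<Sum>b<n. of_real (B a b) * w b))\<^sup>2)"
    and w: "(\<Sum>b<n. (cmod (w b))\<^sup>2) \<le> 1" by blast
  have row: "(cmod (\<Sum>b<n. of_real (B a b) * w b))\<^sup>2 \<le> e * v a * (\<Sum>b<n. B a b * (cmod (w b))\<^sup>2 / v b)"
    if a: "a < n" for a
  proof -
    \<comment> \<open>Each term is split into two square roots weighted by \<open>v\<close>; the
      squares of the first ones add up to the row sum in \<open>right\<close>. After the rows are
      summed, \<open>left\<close> supplies the second factor \<open>e\<close>.\<close>
    have "cmod (\<Sum>b<n. of_real (B a b) * w b) \<le> (\<Sum>b<n. sqrt (B a b * v b) * sqrt (B a b * (cmod (w b))\<^sup>2 / v b))"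
    proof (rule sum_norm_le)
      fix b assume b: "b \<in> {..<n}"
      have "sqrt (B a b * v b) * sqrt (B a b * (cmod (w b))\<^sup>2 / v b) = sqrt ((B a b * cmod (w b))\<^sup>2)"
        unfolding real_sqrt_mult[symmetric] using v[of b] b by (simp add: power2_eq_square field_simps)
      thus "cmod (of_real (B a b) * w b) \<le> sqrt (B a b * v b) * sqrt (B a b * (cmod (w b))\<^sup>2 / v b)"
        using B[of a b] by (simp add: norm_mult)
    qed
    hence "(cmod (\<Sum>b<n. of_real (B a b) * w b))\<^sup>2
        \<le> (\<Sum>b<n. sqrt (B a b * v b) * sqrt (B a b * (cmod (w b))\<^sup>2 / v b))\<^sup>2"
      by (intro power_mono) auto
    also have "\<dots> \<le> (\<Sum>b<n. (sqrt (B a b * v b))\<^sup>2) * (\<Sum>b<n. (sqrt (B a b * (cmod (w b))\<^sup>2 / v b))\<^sup>2)"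
      by (rule Cauchy_Schwarz_ineq_sum)
    also have "\<dots> = (\<Sum>b<n. B a b * v b) * (\<Sum>b<n. B a b * (cmod (w b))\<^sup>2 / v b)"
      using v B by (intro arg_cong2[of _ _ _ _ "(*)"] sum.cong refl real_sqrt_pow2)
        (auto intro!: mult_nonneg_nonneg divide_nonneg_pos simp: less_imp_le)
    finally show ?thesis using right[OF a] by simp
  qed
  have "(\<Sum>a<n. (cmod (\<Sum>b<n. of_real (B a b) * w b))\<^sup>2)
      \<le> (\<Sum>a<n. e * v a * (\<Sum>b<n. B a b * (cmod (w b))\<^sup>2 / v b))"
    using row by (intro sum_mono) auto
  also have "\<dots> = (\<Sum>a<n. \<Sum>b<n. e * ((cmod (w b))\<^sup>2 / v b) * (B a b * v a))"
    by (simp add: sum_distrib_left mult_ac)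
  also have "\<dots> = (\<Sum>b<n. e * ((cmod (w b))\<^sup>2 / v b) * (\<Sum>a<n. B a b * v a))"
    unfolding sum_distrib_left by (rule sum.swap)
  also have "\<dots> = (\<Sum>b<n. e\<^sup>2 * (cmod (w b))\<^sup>2)"
    using v by (intro sum.cong refl) (simp add: left power2_eq_square less_imp_neq[symmetric])
  also have "\<dots> \<le> e\<^sup>2"
    using w by (simp add: sum_distrib_left[symmetric] mult_left_le)
  finally have "x \<le> sqrt (e\<^sup>2)" unfolding x by (rule real_sqrt_le_mono)
  thus "x \<le> e" using e by simp
qed

abbreviation d :: "nat \<Rightarrow> real" where "d \<equiv> dnorm m N"

text \<open>On the common eigenvector \<open>v\<close> each M_j acts by a scalar \<open>e j\<close>,
  and these scalars form a character invariant under the involution. So \<open>v\<close> is an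
  eigenvector of M_j and of its transpose for the same eigenvalue, and the Schur test identifies
  \<open>e j\<close> with the norm of M_j.\<close>

lemma dimension_character:
  shows d_pos: "i < m \<Longrightarrow> 0 < d i"
    and d_dual: "i < m \<Longrightarrow> d (dual i) = d i"
    and d_mult: "i < m \<Longrightarrow> j < m \<Longrightarrow> (\<Sum>l<m. real (N i j l) * d l) = d i * d j"
proof -
  obtain v e where v: "\<And>i. i < m \<Longrightarrow> 0 < v i"
    and ev: "\<And>j k. j < m \<Longrightarrow> k < m \<Longrightarrow> (\<Sum>i<m. real (N j i k) * v i) = e j * v k"
    by (rule positive_common_eigenvector) blast
  have e0: "0 \<le> e j" if j: "j < m" for j
  proof -
    have "0 \<le> e j * v 0"
      unfolding ev[OF j m_pos, symmetric] using v by (intro sum_nonneg) (auto intro!: mult_nonneg_nonneg simp: less_imp_le)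
    thus ?thesis using v[OF m_pos] by (simp add: zero_le_mult_iff)
  qed
  \<comment> \<open>The relation M_i M_j = sum_l N_ij^l M_l is applied to \<open>v\<close> and read
    at coordinate 0, where \<open>v\<close> is positive.\<close>
  have e_mult: "(\<Sum>l<m. real (N i j l) * e l) = e i * e j" if i: "i < m" and j: "j < m" for i j
  proof -
    have assoc: "(\<Sum>l<m. real (N i j l) * real (N l k 0)) = (\<Sum>l<m. real (N j k l) * real (N i l 0))"
      if "k < m" for k
      using arg_cong[OF N_assoc[of i j k 0], of real] that i j m_pos by simp
    have "(\<Sum>l<m. real (N i j l) * e l) * v 0 = (\<Sum>l<m. real (N i j l) * (\<Sum>k<m. real (N l k 0) * v k))"
      using m_pos by (simp add: ev sum_distrib_right mult.assoc)
    also have "\<dots> = (\<Sum>k<m. (\<Sum>l<m. real (N i j l) * real (N l k 0)) * v k)"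
      unfolding sum_distrib_left sum_distrib_right mult.assoc by (rule sum.swap)
    also have "\<dots> = (\<Sum>k<m. (\<Sum>l<m. real (N j k l) * real (N i l 0)) * v k)"
      by (simp add: assoc)
    also have "\<dots> = (\<Sum>l<m. real (N i l 0) * (\<Sum>k<m. real (N j k l) * v k))"
      unfolding sum_distrib_left sum_distrib_right
      by (subst sum.swap) (simp add: mult_ac)
    also have "\<dots> = (\<Sum>l<m. e j * (real (N i l 0) * v l))"
      using j by (intro sum.cong refl) (simp add: ev)
    also have "\<dots> = e i * e j * v 0"
      using ev[OF i m_pos] by (simp add: sum_distrib_left[symmetric])
    finally show ?thesis using v[OF m_pos] by simp
  qed
  have adj: "(\<Sum>i<m. real (N j k i) * v i) = e (dual j) * v k" if "j < m" "k < m" for j k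
  proof -
    have "(\<Sum>i<m. real (N j k i) * v i) = (\<Sum>i<m. real (N (dual j) i k) * v i)"
      using that by (intro sum.cong) (simp_all add: N_transpose[of _ "dual j" k, symmetric])
    thus ?thesis using ev[of "dual j" k] that by simp
  qed
  \<comment> \<open>Pairing \<open>v\<close> with M_j v, and moving M_j to the other side, gives
    both scalars times the squared norm of \<open>v\<close>.\<close>
  have e_dual: "e (dual j) = e j" if j: "j < m" for j
  proof -
    have "e (dual j) * (\<Sum>k<m. (v k)\<^sup>2) = (\<Sum>k<m. v k * (\<Sum>i<m. real (N j k i) * v i))"
      using j by (simp add: adj) (simp add: sum_distrib_left power2_eq_square mult_ac)
    also have "\<dots> = (\<Sum>i<m. v i * (\<Sum>k<m. real (N j k i) * v k))"
      unfolding sum_distrib_left by (subst sum.swap) (simp add: mult_ac)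
    also have "\<dots> = e j * (\<Sum>k<m. (v k)\<^sup>2)"
      using j by (simp add: ev) (simp add: sum_distrib_left power2_eq_square mult_ac)
    finally have "e (dual j) * (\<Sum>k<m. (v k)\<^sup>2) = e j * (\<Sum>k<m. (v k)\<^sup>2)" .
    moreover have "(\<Sum>k<m. (v k)\<^sup>2) > 0"
      using m_pos v by (intro sum_pos) (auto simp: less_imp_neq[symmetric])
    ultimately show ?thesis by simp
  qed
  have e_one: "e 0 = 1"
  proof -
    have "e 0 * v 0 = (\<Sum>i<m. if i = 0 then v i else 0)"
      unfolding ev[OF m_pos m_pos, symmetric] using m_pos by (intro sum.cong) (auto simp: N_unit_left)
    thus ?thesis using v[OF m_pos] m_pos by simp
  qed
  \<comment> \<open>As 1 occurs in x_j x_{j*}, the character gives 1 <= e j * e (dual j), so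
    \<open>e j\<close> is not 0.\<close>
  have e_pos: "0 < e j" if j: "j < m" for j
  proof -
    have "real (N j (dual j) 0) * e 0 \<le> (\<Sum>l<m. real (N j (dual j) l) * e l)"
      using m_pos e0 by (intro member_le_sum) auto
    hence "1 \<le> e j * e (dual j)"
      using j m_pos by (simp add: e_mult N_0 e_one)
    thus ?thesis using e0[OF j] by (cases "e j = 0") auto
  qed
  have d_eq: "d j = e j" if j: "j < m" for j
  proof -
    have "opnorm m (\<lambda>k i. of_real (real (N j i k))) = e j"
    proof (rule opnorm_eqI[OF m_pos v])
      show "(\<Sum>b<m. real (N j b a) * v b) = e j * v a" if "a < m" for a
        using ev[OF j that] .
      show "(\<Sum>a<m. real (N j b a) * v a) = e j * v b" if "b < m" for b
        using adj[OF j that] e_dual[OF j] by simp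
    qed (use e0[OF j] in auto)
    moreover have "fmat N j = (\<lambda>k i. of_real (real (N j i k)))"
      by (simp add: fmat_def fun_eq_iff)
    ultimately show ?thesis by (simp add: dnorm_def)
  qed
  show "0 < d i" if "i < m" using that by (simp add: d_eq e_pos)
  show "d (dual i) = d i" if "i < m" using that by (simp add: d_eq e_dual)
  show "(\<Sum>l<m. real (N i j l) * d l) = d i * d j" if "i < m" "j < m"
    using that by (simp add: d_eq e_mult)
qed

text \<open>\<open>d_mult\<close> says that \<open>d\<close> is an eigenvector of the transposed
  fusion matrices; duality brings this back to the matrices themselves.\<close>

lemma d_eigenvector:
  assumes "j < m" "k < m"
  shows "(\<Sum>i<m. real (N j i k) * d i) = d j * d k"
proof -
  have "(\<Sum>i<m. real (N j i k) * d i) = (\<Sum>i<m. real (N (dual j) k i) * d i)"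
    using assms by (intro sum.cong) (simp_all add: N_transpose)
  thus ?thesis using assms by (simp add: d_mult d_dual)
qed

text \<open>Reciprocity reduces this to \<open>d_mult\<close> for x_k x_{i*}. The left side is an
  entry of T_1, which therefore has rank one.\<close>

lemma sum_d_N:
  assumes "i < m" "k < m"
  shows "(\<Sum>j<m. d j * real (N j i k)) = d k * d i"
proof -
  have "(\<Sum>j<m. d j * real (N j i k)) = (\<Sum>j<m. real (N k (dual i) j) * d j)"
    using assms by (intro sum.cong) (simp_all add: N_right)
  thus ?thesis using assms by (simp add: d_mult d_dual)
qed

end

section \<open>Primary matrices and complete positivity\<close>

lemma finite_tuples: "finite (tuples m n)"
  using finite_lists_length_eq[of "{0..<m}" n] by (simp add: tuples_def conj_commute)

lemma tuples_Suc: "xs \<in> tuples m (Suc n) \<longleftrightarrow> (\<exists>a ys. xs = a # ys \<and> a < m \<and> ys \<in> tuples m n)"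
  by (cases xs) (auto simp: tuples_def)

lemma bij_tuples_Suc:
  assumes h: "bij_betw h K (tuples m n)"
  shows "bij_betw (\<lambda>(p, a). a # h p) (K \<times> {0..<m}) (tuples m (Suc n))"
proof -
  have im: "h ` K = tuples m n" and inj: "inj_on h K" using h by (auto simp: bij_betw_def)
  have "(\<lambda>(p, a). a # h p) ` (K \<times> {0..<m}) = tuples m (Suc n)"
    unfolding set_eq_iff tuples_Suc im[symmetric] by force
  moreover have "inj_on (\<lambda>(p, a). a # h p) (K \<times> {0..<m})"
    using inj by (auto simp: inj_on_def)
  ultimately show ?thesis by (simp add: bij_betw_def)
qed

lemma primary_mat_Cons:
  "primary_mat m N (Suc n) (a # xs) (b # ys) = (\<Sum>i<m. complex_of_real ((dnorm m N i)\<^sup>2) *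
     (fmat N i a b / complex_of_real (dnorm m N i) *
      (\<Prod>t<n. fmat N i (xs ! t) (ys ! t) / complex_of_real (dnorm m N i))))"
  unfolding primary_mat_def prod.lessThan_Suc_shift by simp

text \<open>The first tensor factor is split off while the remaining tuples are enumerated by an
  arbitrary set \<open>K\<close>; for \<open>K\<close> an initial segment of the naturals the right
  side has the shape of \<open>Mk_pos\<close>.\<close>

lemma primary_psd_Suc:
  assumes "bij_betw h K (tuples m n)"
  shows "primary_psd m N (Suc n) \<longleftrightarrow>
    psd (K \<times> {0..<m}) (\<lambda>(p, a) (q, b). primary_mat m N (Suc n) (a # h p) (b # h q))"
  unfolding primary_psd_def by (rule psd_reindex[OF bij_tuples_Suc[OF assms], symmetric]) auto

lemma primary_psd_Suc_Suc:
  assumes h: "bij_betw h K (tuples m n)"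
  shows "primary_psd m N (Suc (Suc n)) \<longleftrightarrow>
    psd (K \<times> ({0..<m} \<times> {0..<m}))
      (\<lambda>(p, (a, a')) (q, (b, b')). primary_mat m N (Suc (Suc n)) (a # a' # h p) (b # b' # h q))"
proof -
  have b: "bij_betw (\<lambda>(p, (a, a')). ((p, a'), a)) (K \<times> ({0..<m} \<times> {0..<m})) ((K \<times> {0..<m}) \<times> {0..<m})"
    by (rule bij_betwI[where g = "\<lambda>((p, a'), a). (p, (a, a'))"]) auto
  show ?thesis
    unfolding primary_psd_Suc[OF bij_tuples_Suc[OF h]]
    by (rule psd_reindex[OF b, symmetric]) auto
qed

text \<open>T_{n+1} is an element of M_k(B) with k = m^n, its first tensor factor being the left
  regular representation of B. As \<Delta> sends x_j to x_j (x) x_j / d_j, the entrywise image is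
  T_{n+2}.\<close>

lemma Delta_cp_primary_step:
  assumes cp: "Delta_cp m N" and psd: "primary_psd m N (Suc n)"
  shows "primary_psd m N (Suc (Suc n))"
proof -
  define k where "k = card (tuples m n)"
  obtain h where h: "bij_betw h {0..<k} (tuples m n)"
    using ex_bij_betw_nat_finite[OF finite_tuples] unfolding k_def by blast
  \<comment> \<open>The coefficient of x_j in the entry (p, q): the weight d_j^2, the 1 / d_j of the
    first factor, and the entry of the other \<open>n\<close> factors.\<close>
  define C where "C = (\<lambda>p q j. complex_of_real ((dnorm m N j)\<^sup>2) / complex_of_real (dnorm m N j) *
      (\<Prod>t<n. fmat N j (h p ! t) (h q ! t) / complex_of_real (dnorm m N j)))"
  have 1: "Bmat m N (C p q) a b = primary_mat m N (Suc n) (a # h p) (b # h q)" for p q a b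
    unfolding Bmat_def primary_mat_Cons C_def by (intro sum.cong refl) simp
  have 2: "Delta_mat m N (C p q) (a, a') (b, b')
      = primary_mat m N (Suc (Suc n)) (a # a' # h p) (b # b' # h q)" for p q a a' b b'
    unfolding Delta_mat_def primary_mat_Cons prod.lessThan_Suc_shift C_def prod.case
    by (intro sum.cong refl) simp
  have "Mk_pos k {0..<m} (\<lambda>p q. Bmat m N (C p q))"
    using psd unfolding Mk_pos_def primary_psd_Suc[OF h] 1 .
  hence "Mk_pos k ({0..<m} \<times> {0..<m}) (\<lambda>p q. Delta_mat m N (C p q))"
    using cp unfolding Delta_cp_def by blast
  thus ?thesis
    unfolding Mk_pos_def primary_psd_Suc_Suc[OF h]
    by (subst psd_cong[where B = "\<lambda>(p, x) (q, y). Delta_mat m N (C p q) x y"]) (auto simp: 2)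
qed

lemma sum_rotate:
  "(\<Sum>a\<in>A. \<Sum>b\<in>B. \<Sum>c\<in>C. f a b c) = (\<Sum>b\<in>B. \<Sum>c\<in>C. \<Sum>a\<in>A. f a b c)"
proof -
  have "(\<Sum>a\<in>A. \<Sum>b\<in>B. \<Sum>c\<in>C. f a b c) = (\<Sum>b\<in>B. \<Sum>a\<in>A. \<Sum>c\<in>C. f a b c)"
    by (rule sum.swap)
  also have "\<dots> = (\<Sum>b\<in>B. \<Sum>c\<in>C. \<Sum>a\<in>A. f a b c)"
    by (rule sum.cong[OF refl]) (rule sum.swap)
  finally show ?thesis .
qed

context fusion
begin

section \<open>Positivity of T_1 and descent in the tensor power\<close>

lemma fmat_d:
  assumes "j < m" "a < m"
  shows "(\<Sum>b<m. fmat N j a b * complex_of_real (d b)) = complex_of_real (d j * d a)"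
proof -
  have "(\<Sum>b<m. fmat N j a b * complex_of_real (d b)) = complex_of_real (\<Sum>b<m. real (N j b a) * d b)"
    by (simp add: fmat_def)
  thus ?thesis using d_eigenvector[OF assms] by simp
qed

lemma primary_psd_1: "primary_psd m N 1"
proof -
  \<comment> \<open>After the first factor is split off no factor remains, so the rest is indexed by
    a one-point set.\<close>
  have "bij_betw (\<lambda>_. []) {()} (tuples m 0)"
    by (auto simp: bij_betw_def tuples_def)
  note * = primary_psd_Suc[OF this, of N]
  have e: "primary_mat m N (Suc 0) [a] [b] = of_real (d a * d b)" if "a < m" "b < m" for a b
  proof -
    have "primary_mat m N (Suc 0) [a] [b] = of_real (\<Sum>j<m. d j * real (N j b a))"
      unfolding primary_mat_Cons of_real_sum
      using d_pos by (intro sum.cong) (simp_all add: fmat_def power2_eq_square)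
    thus ?thesis using sum_d_N[OF that(2,1)] by simp
  qed
  have "psd ({()} \<times> {0..<m}) (\<lambda>(p, a) (q, b). of_real (d a * d b))"
    unfolding psd_def Let_def
  proof
    fix v :: "unit \<times> nat \<Rightarrow> complex"
    \<comment> \<open>T_1 is the rank-one matrix of \<open>d\<close>, so its form at
      \<open>v\<close> is the squared modulus of the pairing \<open>z\<close> of \<open>d\<close>
      with \<open>v\<close>.\<close>
    define z where "z = (\<Sum>s\<in>{()} \<times> {0..<m}. of_real (d (snd s)) * v s)"
    have "cnj z * z = (\<Sum>s\<in>{()} \<times> {0..<m}. \<Sum>t\<in>{()} \<times> {0..<m}.
        cnj (v s) * (case s of (p, a) \<Rightarrow> \<lambda>(q, b). of_real (d a * d b)) t * v t)"
      unfolding z_def cnj_sum sum_product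
      by (intro sum.cong refl) (simp add: case_prod_beta mult_ac)
    moreover have "cnj z * z = of_real ((cmod z)\<^sup>2)"
      by (simp only: complex_norm_square mult.commute)
    ultimately have eq: "(\<Sum>s\<in>{()} \<times> {0..<m}. \<Sum>t\<in>{()} \<times> {0..<m}.
        cnj (v s) * (case s of (p, a) \<Rightarrow> \<lambda>(q, b). of_real (d a * d b)) t * v t) = of_real ((cmod z)\<^sup>2)"
      by simp
    show "Im (\<Sum>s\<in>{()} \<times> {0..<m}. \<Sum>t\<in>{()} \<times> {0..<m}.
        cnj (v s) * (case s of (p, a) \<Rightarrow> \<lambda>(q, b). of_real (d a * d b)) t * v t) = 0 \<and>
      0 \<le> Re (\<Sum>s\<in>{()} \<times> {0..<m}. \<Sum>t\<in>{()} \<times> {0..<m}.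
        cnj (v s) * (case s of (p, a) \<Rightarrow> \<lambda>(q, b). of_real (d a * d b)) t * v t)"
      unfolding eq by simp
  qed
  hence "primary_psd m N (Suc 0)"
    unfolding * by (subst psd_cong[where B = "\<lambda>(p, a) (q, b). of_real (d a * d b)"]) (auto simp: e)
  thus ?thesis by simp
qed

text \<open>The first factor is compressed by \<open>d\<close>. As M_i d = d_i d, every M_i / d_i
  contributes the same number, the squared norm of \<open>d\<close>, which factors out.\<close>

lemma primary_psd_SucD:
  assumes "primary_psd m N (Suc n)"
  shows "primary_psd m N n"
proof -
  have "bij_betw id (tuples m n) (tuples m n)" by simp
  note * = primary_psd_Suc[OF this, of N]
  have b: "bij_betw (\<lambda>(a, xs). (xs, a)) ({0..<m} \<times> tuples m n) (tuples m n \<times> {0..<m})"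
    by (rule bij_betwI[where g = "\<lambda>(xs, a). (a, xs)"]) auto
  have "psd ({0..<m} \<times> tuples m n) (\<lambda>(a, xs) (b, ys). primary_mat m N (Suc n) (a # xs) (b # ys))"
    using assms unfolding * by (subst psd_reindex[OF b]) auto
  from psd_compress[OF this, of "\<lambda>a. of_real (d a)"]
  have c: "psd (tuples m n) (\<lambda>xs ys. \<Sum>a<m. \<Sum>b<m.
      of_real (d a) * primary_mat m N (Suc n) (a # xs) (b # ys) * of_real (d b))"
    by (simp add: atLeast0LessThan)
  define s where "s = (\<Sum>a<m. (d a)\<^sup>2)"
  have s: "s > 0"
    unfolding s_def using m_pos d_pos by (intro sum_pos) (auto simp: less_imp_neq[symmetric])
  have "(\<Sum>a<m. \<Sum>b<m. of_real (d a) * primary_mat m N (Suc n) (a # xs) (b # ys) * of_real (d b))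
      = of_real s * primary_mat m N n xs ys" for xs ys
  proof -
    define Q where "Q = (\<lambda>i. complex_of_real ((d i)\<^sup>2) *
      (\<Prod>t<n. fmat N i (xs ! t) (ys ! t) / complex_of_real (d i)))"
    have "(\<Sum>a<m. \<Sum>b<m. of_real (d a) * primary_mat m N (Suc n) (a # xs) (b # ys) * of_real (d b))
      = (\<Sum>a<m. \<Sum>b<m. \<Sum>i<m. Q i * of_real (d a) / of_real (d i) * (fmat N i a b * of_real (d b)))"
      unfolding primary_mat_Cons Q_def sum_distrib_left sum_distrib_right
      by (intro sum.cong refl) simp
    also have "\<dots> = (\<Sum>i<m. \<Sum>a<m. \<Sum>b<m. Q i * of_real (d a) / of_real (d i) * (fmat N i a b * of_real (d b)))"
      by (rule sum_rotate[symmetric])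
    also have "\<dots> = (\<Sum>i<m. \<Sum>a<m. Q i * of_real ((d a)\<^sup>2))"
      using d_pos by (intro sum.cong refl)
        (subst sum_distrib_left[symmetric], simp add: fmat_d power2_eq_square less_imp_neq[symmetric])
    also have "\<dots> = of_real s * (\<Sum>i<m. Q i)"
      by (simp add: sum_distrib_left[symmetric] sum_distrib_right[symmetric] s_def mult.commute)
    finally show ?thesis by (simp add: primary_mat_def Q_def)
  qed
  with c have "psd (tuples m n) (\<lambda>xs ys. of_real s * primary_mat m N n xs ys)" by simp
  from psd_scale_cancel[OF this s] show ?thesis by (simp add: primary_psd_def)
qed

lemma primary_psd_mono:
  assumes "primary_psd m N n" "k \<le> n"
  shows "primary_psd m N k"
  using assms(2,1) by (induction rule: inc_induct) (auto intro: primary_psd_SucD)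

text \<open>The matrix \<open>T'\<close>: \<open>N j (dual c') (dual c)\<close> is the coefficient of \<open>x\<^sub>c\<close> in
  \<open>x\<^bsub>c'\<^esub> x\<^bsub>j*\<^esub>\<close>.\<close>

definition T3_right :: "nat \<times> nat \<times> nat \<Rightarrow> nat \<times> nat \<times> nat \<Rightarrow> complex" where
  "T3_right = (\<lambda>(c, (a, a')) (c', (b, b')). \<Sum>j<m. of_nat (N j (dual c') (dual c)) *
     (fmat N j a b * fmat N j a' b' / of_real (d j)))"

text \<open>The first index of \<open>T3_right\<close> is the third tensor factor of T_3 relabelled
  by the involution; the weight d_j^2 / d_j^3 becomes 1 / d_j.\<close>

lemma psd_T3_right:
  assumes "primary_psd m N 3"
  shows "psd ({0..<m} \<times> ({0..<m} \<times> {0..<m})) T3_right"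
proof -
  have "bij_betw (\<lambda>c. [dual c]) {0..<m} (tuples m 1)"
  proof (rule bij_betwI[where g = "\<lambda>xs. dual (hd xs)"])
    show "(\<lambda>c. [dual c]) \<in> {0..<m} \<rightarrow> tuples m 1"
      by (auto simp: tuples_def)
    show "(\<lambda>xs. dual (hd xs)) \<in> tuples m 1 \<rightarrow> {0..<m}"
      by (auto simp: tuples_Suc One_nat_def simp del: One_nat_def[symmetric])
  qed (auto simp: tuples_def length_Suc_conv)
  note * = primary_psd_Suc_Suc[OF this, of N]
  have "primary_mat m N (Suc (Suc 1)) (a # a' # [dual c]) (b # b' # [dual c'])
      = T3_right (c, (a, a')) (c', (b, b'))" for a a' b b' c c'
    unfolding T3_right_def One_nat_def primary_mat_Cons prod.lessThan_Suc_shift prod.case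
    using d_pos by (intro sum.cong refl) (simp add: fmat_def power2_eq_square less_imp_neq[symmetric])
  moreover have "primary_psd m N (Suc (Suc 1))" using assms by (simp add: numeral_3_eq_3)
  ultimately show ?thesis
    unfolding * by (subst psd_cong) auto
qed

text \<open>Both sides expand into coefficients of x_b in x_i x_{b'} x_{j*}, with the two
  bracketings; associativity equates them.\<close>

lemma Bmat_T3_right_commute:
  assumes b: "b < m" and b': "b' < m"
  shows "(\<Sum>c<m. Bmat m N x b c * T3_right (c, y) (b', y')) = (\<Sum>c<m. T3_right (b, y) (c, y') * Bmat m N x c b')"
proof -
  obtain a a' where y: "y = (a, a')" by (cases y)
  obtain e e' where y': "y' = (e, e')" by (cases y')
  define E where "E = (\<lambda>j. fmat N j a e * fmat N j a' e' / of_real (d j))"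
  have T3: "T3_right (c, y) (c', y') = (\<Sum>j<m. of_nat (N j (dual c') (dual c)) * E j)" for c c'
    by (simp add: T3_right_def y y' E_def)
  have N_comm: "(\<Sum>c<m. N i c b * N j (dual b') (dual c)) = (\<Sum>c<m. N i b' c * N j (dual c) (dual b))"
    if "i < m" "j < m" for i j
  proof -
    have "(\<Sum>c<m. N i c b * N j (dual b') (dual c)) = (\<Sum>c<m. N b' (dual j) c * N i c b)"
      using that b' N_dual[of b' "dual j"] by (intro sum.cong) simp_all
    also have "\<dots> = (\<Sum>c<m. N i b' c * N c (dual j) b)"
      using that b b' by (intro N_assoc[symmetric]) auto
    also have "\<dots> = (\<Sum>c<m. N i b' c * N j (dual c) (dual b))"
      using that b N_dual[of _ "dual j" b] by (intro sum.cong) simp_all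
    finally show ?thesis .
  qed
  have "(\<Sum>c<m. Bmat m N x b c * T3_right (c, y) (b', y'))
     = (\<Sum>c<m. \<Sum>i<m. \<Sum>j<m. x i * E j * of_nat (N i c b * N j (dual b') (dual c)))"
    by (simp add: Bmat_def T3 sum_product fmat_def mult_ac)
  also have "\<dots> = (\<Sum>i<m. \<Sum>j<m. x i * E j * of_nat (\<Sum>c<m. N i c b * N j (dual b') (dual c)))"
    unfolding of_nat_sum sum_distrib_left by (rule sum_rotate)
  also have "\<dots> = (\<Sum>i<m. \<Sum>j<m. x i * E j * of_nat (\<Sum>c<m. N i b' c * N j (dual c) (dual b)))"
    by (intro sum.cong refl) (simp only: N_comm lessThan_iff)
  also have "\<dots> = (\<Sum>c<m. \<Sum>i<m. \<Sum>j<m. x i * E j * of_nat (N i b' c * N j (dual c) (dual b)))"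
    unfolding of_nat_sum sum_distrib_left by (rule sum_rotate[symmetric])
  also have "\<dots> = (\<Sum>c<m. Bmat m N x c b' * (\<Sum>j<m. of_nat (N j (dual c) (dual b)) * E j))"
    by (simp add: Bmat_def sum_product fmat_def mult_ac)
  finally show ?thesis by (simp add: T3 mult.commute)
qed

text \<open>For each \<open>c\<close> only the basis element \<open>dual c\<close> survives in row 0
  of \<open>Bmat\<close>, and likewise in column 0 of the first factor of \<open>T3_right\<close>.
  So the product picks out the diagonal terms, which are those of \<Delta>.\<close>

lemma Delta_mat_eq:
  "Delta_mat m N x y y' = (\<Sum>c<m. Bmat m N x 0 c * T3_right (c, y) (0, y'))"
proof -
  obtain a a' where y: "y = (a, a')" by (cases y)
  obtain e e' where y': "y' = (e, e')" by (cases y')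
  define E where "E = (\<lambda>j. fmat N j a e * fmat N j a' e' / of_real (d j))"
  have T3: "T3_right (c, y) (c', y') = (\<Sum>j<m. of_nat (N j (dual c') (dual c)) * E j)" for c c'
    by (simp add: T3_right_def y y' E_def)
  have "Bmat m N x 0 c * T3_right (c, y) (0, y') = x (dual c) * E (dual c)" if c: "c < m" for c
  proof -
    have "Bmat m N x 0 c = (\<Sum>j<m. if j = dual c then x j else 0)"
      unfolding Bmat_def using c by (intro sum.cong) (simp_all add: fmat_def N_0)
    moreover have "T3_right (c, y) (0, y') = (\<Sum>j<m. if j = dual c then E j else 0)"
      unfolding T3 using c by (intro sum.cong) (simp_all add: dual_0 N_unit_right)
    ultimately show ?thesis using c by simp
  qed
  hence "(\<Sum>c<m. Bmat m N x 0 c * T3_right (c, y) (0, y')) = (\<Sum>c<m. x (dual c) * E (dual c))"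
    by simp
  also have "\<dots> = (\<Sum>j<m. x j * E j)"
    by (rule sum_dual)
  finally show ?thesis by (simp add: Delta_mat_def y y' E_def mult.assoc)
qed

lemma Delta_cp_if_primary_psd_3:
  assumes T3: "primary_psd m N 3"
  shows "Delta_cp m N"
  unfolding Delta_cp_def
proof (intro allI impI)
  fix k C
  assume C: "Mk_pos k {0..<m} (\<lambda>p q. Bmat m N (C p q))"
  define I where "I = {0..<m}"
  define P where "P = {0..<k}"
  define K where "K = I \<times> I"
  have fin: "finite I" "finite P" "finite K" by (simp_all add: I_def P_def K_def)
  \<comment> \<open>In an index (b, (p, y)), \<open>b\<close> belongs to the shared copy of L^2(B),
    \<open>p\<close> to the k by k matrices and \<open>y\<close> to the two factors of the target.
    \<open>A\<close> is the given positive element, acting as the identity on \<open>y\<close>;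
    \<open>B\<close> is \<open>T3_right\<close>, acting as the identity on \<open>p\<close>.\<close>
  define A :: "nat \<times> nat \<times> nat \<times> nat \<Rightarrow> nat \<times> nat \<times> nat \<times> nat \<Rightarrow> complex"
    where "A = (\<lambda>(b, (p, y)) (b', (q, y')). if y = y' then Bmat m N (C p q) b b' else 0)"
  define B :: "nat \<times> nat \<times> nat \<times> nat \<Rightarrow> nat \<times> nat \<times> nat \<times> nat \<Rightarrow> complex"
    where "B = (\<lambda>(b, (p, y)) (b', (q, y')). if p = q then T3_right (b, y) (b', y') else 0)"
  let ?J = "I \<times> (P \<times> K)"
  have psdA: "psd ?J A"
  proof -
    have b: "bij_betw (\<lambda>(b, (p, y)). ((p, b), y)) ?J ((P \<times> I) \<times> K)"
      by (rule bij_betwI[where g = "\<lambda>((p, b), y). (b, (p, y))"]) auto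
    have "psd (P \<times> I) (\<lambda>(p, x) (q, y). Bmat m N (C p q) x y)"
      using C by (simp add: Mk_pos_def P_def I_def)
    from psd_tensor_id[OF fin(3) this] show ?thesis
      by (subst psd_reindex[OF b]) (auto simp: A_def)
  qed
  have psdB: "psd ?J B"
  proof -
    have b: "bij_betw (\<lambda>(b, (p, y)). ((b, y), p)) ?J ((I \<times> K) \<times> P)"
      by (rule bij_betwI[where g = "\<lambda>((b, y), p). (b, (p, y))"]) auto
    have "psd (I \<times> K) T3_right"
      using psd_T3_right[OF T3] by (simp add: K_def I_def)
    from psd_tensor_id[OF fin(2) this] show ?thesis
      by (subst psd_reindex[OF b]) (auto simp: B_def)
  qed
  have AB: "kmult ?J A B (b, (p, y)) (b', (q, y')) = (\<Sum>c<m. Bmat m N (C p q) b c * T3_right (c, y) (b', y'))"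
    if "p \<in> P" "q \<in> P" "y \<in> K" "y' \<in> K" for b p y b' q y'
  proof -
    have "kmult ?J A B (b, (p, y)) (b', (q, y')) = (\<Sum>c\<in>I. \<Sum>r\<in>P. \<Sum>z\<in>K.
        (if y = z then Bmat m N (C p r) b c else 0) * (if r = q then T3_right (c, z) (b', y') else 0))"
      by (simp add: kmult_def sum_Times A_def B_def)
    also have "\<dots> = (\<Sum>c\<in>I. \<Sum>r\<in>P. if r = q then Bmat m N (C p r) b c * T3_right (c, y) (b', y') else 0)"
      using that fin by (intro sum.cong refl) (simp add: if_distrib[of "\<lambda>x. x * _"] cong: if_cong)
    also have "\<dots> = (\<Sum>c\<in>I. Bmat m N (C p q) b c * T3_right (c, y) (b', y'))"
      using that fin by simp
    finally show ?thesis by (simp add: I_def atLeast0LessThan)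
  qed
  have BA: "kmult ?J B A (b, (p, y)) (b', (q, y')) = (\<Sum>c<m. T3_right (b, y) (c, y') * Bmat m N (C p q) c b')"
    if "p \<in> P" "q \<in> P" "y \<in> K" "y' \<in> K" for b p y b' q y'
  proof -
    have "kmult ?J B A (b, (p, y)) (b', (q, y')) = (\<Sum>c\<in>I. \<Sum>r\<in>P. \<Sum>z\<in>K.
        (if p = r then T3_right (b, y) (c, z) else 0) * (if z = y' then Bmat m N (C r q) c b' else 0))"
      by (simp add: kmult_def sum_Times A_def B_def)
    also have "\<dots> = (\<Sum>c\<in>I. \<Sum>r\<in>P. if p = r then T3_right (b, y) (c, y') * Bmat m N (C r q) c b' else 0)"
      using that fin by (intro sum.cong refl) (simp add: if_distrib[of "\<lambda>x. _ * x"] cong: if_cong)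
    also have "\<dots> = (\<Sum>c\<in>I. T3_right (b, y) (c, y') * Bmat m N (C p q) c b')"
      using that fin by simp
    finally show ?thesis by (simp add: I_def atLeast0LessThan)
  qed
  have "hermitian_on ?J (kmult ?J A B)"
  proof (rule hermitian_kmult)
    show "hermitian_on ?J A" "hermitian_on ?J B"
      using psdA psdB fin by (auto intro!: psd_hermitian)
    fix s t assume st: "s \<in> ?J" "t \<in> ?J"
    obtain b p y where s: "s = (b, (p, y))" by (metis surj_pair)
    obtain b' q y' where t: "t = (b', (q, y'))" by (metis surj_pair)
    have "b < m" "b' < m" using st by (auto simp: s t I_def)
    thus "kmult ?J A B s t = kmult ?J B A s t"
      using st unfolding s t by (simp add: AB BA Bmat_T3_right_commute)
  qed
  with psdA psdB fin have "psd ?J (kmult ?J A B)"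
    by (intro psd_kmult) auto
  \<comment> \<open>Compression of the shared factor to the unit x_1, whose index is 0.\<close>
  from psd_compress[OF this, of "\<lambda>a. if a = 0 then 1 else 0"]
  have "psd (P \<times> K) (\<lambda>x y. kmult ?J A B (0, x) (0, y))"
    using m_pos by (simp add: I_def if_distrib[of cnj] if_distrib[of "\<lambda>x. x * _"] if_distrib[of "\<lambda>x. _ * x"]
        cong: if_cong)
  moreover have "psd (P \<times> K) (\<lambda>x y. kmult ?J A B (0, x) (0, y)) \<longleftrightarrow>
      psd (P \<times> K) (\<lambda>(p, x) (q, y). Delta_mat m N (C p q) x y)"
    by (rule psd_cong) (auto simp: AB Delta_mat_eq)
  ultimately have "psd (P \<times> K) (\<lambda>(p, x) (q, y). Delta_mat m N (C p q) x y)" by blast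
  thus "Mk_pos k ({0..<m} \<times> {0..<m}) (\<lambda>p q. Delta_mat m N (C p q))"
    by (simp add: Mk_pos_def P_def K_def I_def)
qed

text \<open>Induction from T_1; each application of \<Delta> raises the tensor power by one.\<close>

lemma primary_psd_if_Delta_cp:
  assumes "Delta_cp m N"
  shows "primary_psd m N (Suc n)"
  using primary_psd_1 Delta_cp_primary_step[OF assms] by (induction n) simp_all

end

theorem mainTheorem4:
  fixes m :: nat and N :: "nat \<Rightarrow> nat \<Rightarrow> nat \<Rightarrow> nat" and dual :: "nat \<Rightarrow> nat"
  assumes "fusion_ring m N dual"
  shows "(Delta_cp m N \<longleftrightarrow> primary_psd m N 3)
       \<and> (primary_psd m N 3 \<longleftrightarrow> (\<exists>n\<ge>3. primary_psd m N n))
       \<and> ((\<exists>n\<ge>3. primary_psd m N n) \<longleftrightarrow> (\<forall>n\<ge>1. primary_psd m N n))"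
proof -
  interpret fusion m N dual using assms by unfold_locales
  have 12: "Delta_cp m N \<longleftrightarrow> primary_psd m N 3"
    using Delta_cp_if_primary_psd_3 primary_psd_if_Delta_cp[of 2] by (auto simp: numeral_3_eq_3 numeral_2_eq_2)
  have 32: "primary_psd m N 3" if "\<exists>n\<ge>3. primary_psd m N n"
    using that primary_psd_mono by blast
  have 14: "primary_psd m N n" if "Delta_cp m N" "n \<ge> 1" for n
    using primary_psd_if_Delta_cp[OF that(1), of "n - 1"] that(2) by simp
  have 43: "\<exists>n\<ge>3. primary_psd m N n" if "\<forall>n\<ge>1. primary_psd m N n"
    using that by (intro exI[of _ 3]) simp
  show ?thesis using 12 32 14 43 by blast
qed

end
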